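(* Let $K$ be a field of characteristic not equal to $2$, let $f(z)=z^2+c\in K[z]$ with $0$ strictly preperiodic and with $r=3$, $s=2$ the minimal integers $r>s$ with $f^r(0)=-f^s(0)$. Let $x_0\in K$ not lie in the forward orbit $\{f^i(0):i\ge0\}$ of $0$, and fix choices of $\sqrt2\in\overline K$ and of a primitive $4$-th root of unity $\zeta_4\in\overline K$. Suppose the tree of preimages of $x_0$ is labeled so that for every word $x$: (i) $\dfrac{\prod_{w\in\{a,b\}^{2}}[xawa]}{\prod_{w'\in\{a,b\}}[xbw'a]}=\dfrac{\prod_{w\in\{a,b\}^{2}}[xbwa]}{\prod_{w'\in\{a,b\}}[xaw'a]}=\zeta_4$, and (ii) $\dfrac{\gamma_{aa}(x)\gamma_{ab}(x)\gamma_{ba}(x)\gamma_{bb}(x)}{4(c^2+c+1)(2+U_a(x)+U_b(x))}=\sqrt2$ (such a labeling exists). Then for every node $x$ and every $\sigma\in G_\infty=\mathrm{Gal}(K_\infty/K)$, $\sigma(\sqrt2)=(-1)^{R_{3,2}(\sigma,x)}\sqrt2$. In particular, the image of $G_\infty$ in $\mathrm{Aut}(T_\infty)$ induced by this labeling is contained in $\tilde M_{3,2,\infty}$. Furthermore, if $\zeta_4,\sqrt2\in K$, then this image is contained in $\tilde B_{3,2,\infty}$.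
   Context: Labeling: assign to each word $w$ in $\{a,b\}$ of length $n$ a point $[w]\in f^{-n}(x_0)\subset\overline K$ with $[\,]=x_0$, bijectively on each level, such that $[wa],[wb]=-[wa]$ are the two roots of $f(z)=[w]$. For $w\in\{a,b\}^2$, $\gamma_w(x)=[xwaaa][xwaba][xwba]+[xwbaa][xwbba][xwaa]$; $U_a(x)=c[xaaa][xaba]$, $U_b(x)=c[xbaa][xbba]$. $K_\infty=\bigcup_nK(f^{-n}(x_0))$; $\sigma\in G_\infty$ acts on words by $[\sigma(w)]=\sigma([w])$, giving $G_\infty\to\mathrm{Aut}(T_\infty)$ ($T_\infty$ the binary rooted tree of words). $\mathrm{Par}(\sigma,x)\in\mathbb{Z}/2\mathbb{Z}$ is $0$ if $\sigma(xa)=\sigma(x)a$, $1$ otherwise. $P^a_{3,2}(\sigma,x)=\sum_{w\in\{a,b\}^2}\mathrm{Par}(\sigma,xaw)+\sum_{w'\in\{a,b\}}\mathrm{Par}(\sigma,xbw')$, $P^b_{3,2}$ the same with $a,b$ swapped after $x$; $M_{3,2,\infty}$ = set of $\sigma$ with all these values over all nodes equal (common value $P_{3,2}(\sigma)$), $B_{3,2,\infty}=\{P_{3,2}=0\}$. $R_{3,2}(\sigma,x)=\sum_{w\in\{a,b\}^2}[\mathrm{Par}(\sigma,xw)+\mathrm{Par}(\sigma,xwb)+\sum_{t\in\{a,b\}}\mathrm{Par}(\sigma,xwat)]+[\mathrm{Par}(\sigma,xaa)+\mathrm{Par}(\sigma,xab)][\mathrm{Par}(\sigma,xba)+\mathrm{Par}(\sigma,xbb)]$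 mod 2. $\tilde M_{3,2,\infty}=\{\sigma\in M_{3,2,\infty}:R_{3,2}(\sigma,x)\text{ independent of }x\}$ with common value $R_{3,2}(\sigma)$; $\tilde B_{3,2,\infty}=\{\sigma\in\tilde M_{3,2,\infty}\cap B_{3,2,\infty}:R_{3,2}(\sigma)=0\}$. *)

theory Defs
  imports
    "HOL-Library.Z2"
    "HOL-Library.FuncSet"
    "HOL-Algebra.Algebra"
    "HOL-Algebra.Algebraic_Closure_Type"
begin

subsection \<open>The map and the orbit of the critical point\<close>

definition quad :: "'a::field \<Rightarrow> 'a \<Rightarrow> 'a" where
  "quad c z = z ^ 2 + c"

definition strictly_preperiodic :: "('a \<Rightarrow> 'a) \<Rightarrow> 'a \<Rightarrow> bool" where
  "strictly_preperiodic f z \<longleftrightarrow>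
     (\<exists>m n. m < n \<and> (f ^^ m) z = (f ^^ n) z) \<and> (\<forall>n>0. (f ^^ n) z \<noteq> z)"

text \<open>Both entries of the pair are required to be minimal among all admissible pairs.\<close>

definition minimal_opposite :: "('a::field \<Rightarrow> 'a) \<Rightarrow> nat \<Rightarrow> nat \<Rightarrow> bool" where
  "minimal_opposite f r s \<longleftrightarrow>
     s < r \<and> (f ^^ r) 0 = - (f ^^ s) 0 \<and>
     (\<forall>r' s'. s' < r' \<and> (f ^^ r') 0 = - (f ^^ s') 0 \<longrightarrow> r \<le> r' \<and> s \<le> s')"

subsection \<open>Words and the binary rooted tree\<close>

datatype letter = A | B

type_synonym word = "letter list"

fun other :: "letter \<Rightarrow> letter" where
  "other A = B"
| "other B = A"

definition words :: "nat \<Rightarrow> word set" where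
  "words n = {w. length w = n}"

text \<open>The word \<open>x\<close> followed by the letter \<open>l\<close> is \<open>x @ [l]\<close>, a child of the node \<open>x\<close>.\<close>

definition is_child :: "word \<Rightarrow> word \<Rightarrow> bool" where
  "is_child x y \<longleftrightarrow> (\<exists>l. y = x @ [l])"

definition tree_aut :: "(word \<Rightarrow> word) set" where
  "tree_aut = {g. bij g \<and> g [] = [] \<and> (\<forall>x y. is_child (g x) (g y) \<longleftrightarrow> is_child x y)}"

definition Par :: "(word \<Rightarrow> word) \<Rightarrow> word \<Rightarrow> bit" where
  "Par g x = (if g (x @ [A]) = g x @ [A] then 0 else 1)"

text \<open>\<open>P32 g A\<close> and \<open>P32 g B\<close> are $P^a_{3,2}$ and $P^b_{3,2}$.\<close>

definition P32 :: "(word \<Rightarrow> word) \<Rightarrow> letter \<Rightarrow> word \<Rightarrow> bit" where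
  "P32 g l x = (\<Sum>w\<in>words 2. Par g (x @ [l] @ w)) + (\<Sum>w\<in>words 1. Par g (x @ [other l] @ w))"

definition M32 :: "(word \<Rightarrow> word) set" where
  "M32 = {g \<in> tree_aut. \<exists>p. \<forall>x. P32 g A x = p \<and> P32 g B x = p}"

definition B32 :: "(word \<Rightarrow> word) set" where
  "B32 = {g \<in> M32. \<forall>x. P32 g A x = 0 \<and> P32 g B x = 0}"

definition R32 :: "(word \<Rightarrow> word) \<Rightarrow> word \<Rightarrow> bit" where
  "R32 g x =
     (\<Sum>w\<in>words 2. Par g (x @ w) + Par g (x @ w @ [B]) + (\<Sum>t\<in>UNIV. Par g (x @ w @ [A, t])))
     + (Par g (x @ [A, A]) + Par g (x @ [A, B])) * (Par g (x @ [B, A]) + Par g (x @ [B, B]))"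

definition Mtilde32 :: "(word \<Rightarrow> word) set" where
  "Mtilde32 = {g \<in> M32. \<exists>r. \<forall>x. R32 g x = r}"

definition Btilde32 :: "(word \<Rightarrow> word) set" where
  "Btilde32 = {g \<in> Mtilde32 \<inter> B32. \<forall>x. R32 g x = 0}"

definition sign_of :: "bit \<Rightarrow> 'a::ring_1" where
  "sign_of e = (if e = 0 then 1 else - 1)"

subsection \<open>Iterated preimages, the field they generate, and its Galois group\<close>

definition preimages :: "'k::field \<Rightarrow> 'k \<Rightarrow> nat \<Rightarrow> 'k alg_closure set" where
  "preimages c x0 n = {z. (quad (to_ac c) ^^ n) z = to_ac x0}"

definition K_inf :: "'k::field \<Rightarrow> 'k \<Rightarrow> 'k alg_closure set" where
  "K_inf c x0 = generate_field ring_of_type_algebra (range to_ac \<union> (\<Union>n. preimages c x0 n))"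

definition K_inf_ring :: "'k::field \<Rightarrow> 'k \<Rightarrow> 'k alg_closure ring" where
  "K_inf_ring c x0 = ring_of_type_algebra\<lparr>carrier := K_inf c x0\<rparr>"

text \<open>Extensionality fixes the values outside \<open>K_inf c x0\<close>, so that each automorphism of
  that field is represented by exactly one function.\<close>

definition galois_inf :: "'k::field \<Rightarrow> 'k \<Rightarrow> ('k alg_closure \<Rightarrow> 'k alg_closure) set" where
  "galois_inf c x0 =
     {\<sigma> \<in> ring_iso (K_inf_ring c x0) (K_inf_ring c x0) \<inter> extensional (K_inf c x0).
        \<forall>u. \<sigma> (to_ac u) = to_ac u}"

subsection \<open>Labelings\<close>

text \<open>If \<open>x0\<close> is periodic, the same point occurs on several levels of the tree.  A labeling is
  therefore injective only level by level, and the action of the Galois group on words has to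
  refer to the level.\<close>

definition labeling :: "'k::field \<Rightarrow> 'k \<Rightarrow> (word \<Rightarrow> 'k alg_closure) \<Rightarrow> bool" where
  "labeling c x0 lab \<longleftrightarrow>
     lab [] = to_ac x0 \<and>
     (\<forall>n. bij_betw lab (words n) (preimages c x0 n)) \<and>
     (\<forall>w. {z. quad (to_ac c) z = lab w} = {lab (w @ [A]), lab (w @ [B])} \<and>
          lab (w @ [B]) = - lab (w @ [A]))"

definition tree_action ::
  "(word \<Rightarrow> 'k::field alg_closure) \<Rightarrow> ('k alg_closure \<Rightarrow> 'k alg_closure) \<Rightarrow> word \<Rightarrow> word" where
  "tree_action lab \<sigma> w = (THE v. length v = length w \<and> lab v = \<sigma> (lab w))"

definition gam :: "(word \<Rightarrow> 'a::field) \<Rightarrow> word \<Rightarrow> word \<Rightarrow> 'a" where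
  "gam lab w x =
     lab (x @ w @ [A, A, A]) * lab (x @ w @ [A, B, A]) * lab (x @ w @ [B, A])
     + lab (x @ w @ [B, A, A]) * lab (x @ w @ [B, B, A]) * lab (x @ w @ [A, A])"

definition Uval :: "'a::field \<Rightarrow> (word \<Rightarrow> 'a) \<Rightarrow> letter \<Rightarrow> word \<Rightarrow> 'a" where
  "Uval c lab l x = c * lab (x @ [l, A, A]) * lab (x @ [l, B, A])"

text \<open>In the next two conditions, \<open>\<zeta>\<close> and \<open>s\<close> will be nonzero.  Since division by zero
  yields zero, the equations imply that the denominators are nonzero.\<close>

definition zeta4_condition :: "(word \<Rightarrow> 'a::field) \<Rightarrow> 'a \<Rightarrow> bool" where
  "zeta4_condition lab \<zeta> \<longleftrightarrow>
     (\<forall>x. (\<Prod>w\<in>words 2. lab (x @ [A] @ w @ [A])) / (\<Prod>w\<in>words 1. lab (x @ [B] @ w @ [A])) = \<zeta> \<and>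
          (\<Prod>w\<in>words 2. lab (x @ [B] @ w @ [A])) / (\<Prod>w\<in>words 1. lab (x @ [A] @ w @ [A])) = \<zeta>)"

definition sqrt2_condition :: "'a::field \<Rightarrow> (word \<Rightarrow> 'a) \<Rightarrow> 'a \<Rightarrow> bool" where
  "sqrt2_condition c lab s \<longleftrightarrow>
     (\<forall>x. (gam lab [A, A] x * gam lab [A, B] x * gam lab [B, A] x * gam lab [B, B] x)
          / (4 * (c ^ 2 + c + 1) * (2 + Uval c lab A x + Uval c lab B x)) = s)"

definition primitive_root_of_unity :: "nat \<Rightarrow> 'a::field \<Rightarrow> bool" where
  "primitive_root_of_unity n \<zeta> \<longleftrightarrow> n > 0 \<and> \<zeta> ^ n = 1 \<and> (\<forall>k. 0 < k \<and> k < n \<longrightarrow> \<zeta> ^ k \<noteq> 1)"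

definition good_labeling ::
  "'k::field \<Rightarrow> 'k \<Rightarrow> 'k alg_closure \<Rightarrow> 'k alg_closure \<Rightarrow> (word \<Rightarrow> 'k alg_closure) \<Rightarrow> bool" where
  "good_labeling c x0 \<zeta> s lab \<longleftrightarrow>
     labeling c x0 lab \<and> zeta4_condition lab \<zeta> \<and> sqrt2_condition (to_ac c) lab s"

end

theory Submission
  imports Defs
begin

text \<open>
  Both labeling conditions hold up to sign in every tree of preimages, because all quantities in
  them have explicit squares: the square of the product of two labels $[zaa][zba]$ is
  $c^2 + c - [z]$, and the relation $c^3 + 2c^2 + 2c + 2 = 0$ does the rest.  Flipping suitable
  pairs of labels on the newest level repairs the signs.

  Applying $\sigma$ to the condition for $\zeta_4$ gives $\sigma(\zeta_4) = (-1)^P \zeta_4$ for each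
  value $P$ of $P^a_{3,2}$ and $P^b_{3,2}$.  Write $\gamma_w(x) = T_a + T_b$.  Then $\sigma$ maps
  $\gamma_w(x)$ to a signed $T_a \pm T_b$ at $\sigma(x)$, and it changes the signs of $U_a$ and
  $U_b$.  The identity $U_a^2 + U_b^2 = 4$ shows that any such nontrivial change of
  signs replaces $\sqrt 2$ by $-\sqrt 2$ in the second condition; this accounts for the quadratic
  term of $R_{3,2}$.
\<close>

section \<open>Short words, and signs indexed by the integers mod 2\<close>

declare add_bit_eq_xor [simp del] mult_bit_eq_and [simp del]

text \<open>With everything on one side, a call of \<open>Groebner_Basis.algebra\<close> with
  hypotheses becomes an ideal membership question.\<close>

lemmas eq_diff_0 = right_minus_eq [THEN iffD2]
lemmas diff_0_eq = right_minus_eq [THEN iffD1]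

lemma words_1: "words 1 = {[A], [B]}"
proof -
  have "w = [A] \<or> w = [B]" if "length w = 1" for w
    using that letter.exhaust by (metis length_0_conv length_Suc_conv One_nat_def)
  then show ?thesis by (auto simp: words_def)
qed

lemma words_2: "words 2 = {[A, A], [A, B], [B, A], [B, B]}"
proof -
  have "w \<in> {[A, A], [A, B], [B, A], [B, B]}" if "length w = 2" for w
  proof -
    from that obtain k l where "w = [k, l]"
      by (metis (no_types) Suc_1 length_0_conv length_Suc_conv One_nat_def)
    then show ?thesis by (cases k; cases l) simp_all
  qed
  then show ?thesis by (auto simp: words_def)
qed

lemma other_other [simp]: "other (other l) = l"
  by (cases l) simp_all

lemma sign_of_0 [simp]: "sign_of 0 = 1"
  by (simp add: sign_of_def)

lemma sign_of_1 [simp]: "sign_of 1 = - 1"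
  by (simp add: sign_of_def)

lemma sign_of_add: "sign_of (e + e') = sign_of e * sign_of e'"
  by (cases e; cases e') simp_all

lemma sign_of_eq_iff:
  assumes "(2 :: 'a::field) \<noteq> 0"
  shows "(sign_of e :: 'a) = sign_of e' \<longleftrightarrow> e = e'"
proof -
  have "(1 :: 'a) \<noteq> - 1"
    using assms by (metis add.right_inverse one_add_one)
  from this this[symmetric] show ?thesis by (cases e; cases e') simp_all
qed

subsection \<open>Algebraic identities along the tree\<close>

text \<open>A labeling of the first \<open>n\<close> levels; longer words are unconstrained, so that
  a labeling can be built level by level. Nonvanishing reflects that the root avoids the forward
  orbit of 0: a label 0 on level i would make the root f^i(0).\<close>

definition rooted :: "'a::field \<Rightarrow> nat \<Rightarrow> (word \<Rightarrow> 'a) \<Rightarrow> bool" where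
  "rooted c n L \<longleftrightarrow>
     (\<forall>w. length w < n \<longrightarrow> L (w @ [A]) ^ 2 = L w - c \<and> L (w @ [B]) = - L (w @ [A])) \<and>
     (\<forall>w. length w \<le> n \<longrightarrow> L w \<noteq> 0)"

lemma rootedD:
  assumes "rooted c n L" "length w < n"
  shows "L (w @ [A]) ^ 2 = L w - c" "L (w @ [B]) = - L (w @ [A])"
  using assms by (auto simp: rooted_def)

text \<open>Condition (i), the numbers U and both terms of gamma are built from such products, whose
  squares depend only on \<open>c\<close> and the label of \<open>z\<close>.\<close>

definition pairprod :: "(word \<Rightarrow> 'a::field) \<Rightarrow> word \<Rightarrow> 'a" where
  "pairprod L z = L (z @ [A, A]) * L (z @ [B, A])"

text \<open>The two terms T_a and T_b of gamma at \<open>y\<close>.\<close>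

definition gterm :: "(word \<Rightarrow> 'a::field) \<Rightarrow> word \<Rightarrow> letter \<Rightarrow> 'a" where
  "gterm L y l = pairprod L (y @ [l]) * L (y @ [other l, A])"

text \<open>\<open>twist L 0\<close> is $\gamma$ and \<open>twist L 1\<close> its conjugate $T_a - T_b$.\<close>

definition twist :: "(word \<Rightarrow> 'a::field) \<Rightarrow> bit \<Rightarrow> word \<Rightarrow> 'a" where
  "twist L e y = gterm L y A + sign_of e * gterm L y B"

text \<open>For \<open>e = 0\<close> this is half of the numerator of condition (ii): the product of
  gamma over the two words that begin with \<open>m\<close>.\<close>

definition twist2 :: "(word \<Rightarrow> 'a::field) \<Rightarrow> bit \<Rightarrow> word \<Rightarrow> letter \<Rightarrow> 'a" where
  "twist2 L e x m = twist L e (x @ [m, A]) * twist L e (x @ [m, B])"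

text \<open>Condition (i) at one node and for one letter, cleared of its denominator. It involves
  labels up to 4 levels below \<open>x\<close> and can thus be tested on a partial labeling.\<close>

definition zeta_at :: "(word \<Rightarrow> 'a::field) \<Rightarrow> 'a \<Rightarrow> word \<Rightarrow> letter \<Rightarrow> bool" where
  "zeta_at L \<zeta> x l \<longleftrightarrow>
     pairprod L (x @ [l, A]) * pairprod L (x @ [l, B]) = \<zeta> * pairprod L (x @ [other l])"

definition sqrt_at :: "'a::field \<Rightarrow> (word \<Rightarrow> 'a) \<Rightarrow> 'a \<Rightarrow> word \<Rightarrow> bool" where
  "sqrt_at c L s x \<longleftrightarrow>
     twist2 L 0 x A * twist2 L 0 x B
       = 4 * (c ^ 2 + c + 1) * (2 + Uval c L A x + Uval c L B x) * s"

lemma gam_eq_twist: "gam L w x = twist L 0 (x @ w)"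
  by (simp add: gam_def twist_def gterm_def pairprod_def)

lemma Uval_eq_pairprod: "Uval c L l x = c * pairprod L (x @ [l])"
  by (simp add: Uval_def pairprod_def)

lemma rooted_nonzero:
  assumes "rooted c n L" "length w \<le> n"
  shows "L w \<noteq> 0"
  using assms by (auto simp: rooted_def)

lemma pairprod_nonzero:
  assumes "rooted c n L" "length z + 2 \<le> n"
  shows "pairprod L z \<noteq> 0"
  using assms by (simp add: pairprod_def rooted_nonzero)

text \<open>Since [za]^2 = [z] - c and [zb] = -[za], the square is ([za] - c)(-[za] - c) = c^2 -
  [za]^2.\<close>

lemma pairprod_sq:
  assumes "rooted c n L" "length z + 2 \<le> n"
  shows "pairprod L z ^ 2 = c ^ 2 + c - L z"
proof -
  have *: "L (z @ [A, A]) ^ 2 = L (z @ [A]) - c" "L (z @ [B, A]) ^ 2 = - L (z @ [A]) - c"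
    "L (z @ [A]) ^ 2 = L z - c"
    using assms rootedD[OF assms(1), of "z @ [A]"] rootedD[OF assms(1), of "z @ [B]"]
      rootedD[OF assms(1), of z]
    by simp_all
  show ?thesis
    unfolding pairprod_def using *[THEN eq_diff_0] by - (rule diff_0_eq, Groebner_Basis.algebra)
qed

lemma gterm_sq:
  assumes "rooted c n L" "length y + 3 \<le> n"
  shows "gterm L y A ^ 2 = (c ^ 2 + c - L (y @ [A])) * (- L (y @ [A]) - c)"
    and "gterm L y B ^ 2 = (c ^ 2 + c + L (y @ [A])) * (L (y @ [A]) - c)"
proof -
  have "L (y @ [A, A]) ^ 2 = L (y @ [A]) - c" "L (y @ [B, A]) ^ 2 = - L (y @ [A]) - c"
    using assms rootedD[OF assms(1), of "y @ [A]"] rootedD[OF assms(1), of "y @ [B]"]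
      rootedD[OF assms(1), of y]
    by simp_all
  moreover have "L (y @ [B]) = - L (y @ [A])"
    using assms rootedD[OF assms(1), of y] by simp
  ultimately show "gterm L y A ^ 2 = (c ^ 2 + c - L (y @ [A])) * (- L (y @ [A]) - c)"
    and "gterm L y B ^ 2 = (c ^ 2 + c + L (y @ [A])) * (L (y @ [A]) - c)"
    using pairprod_sq[OF assms(1), of "y @ [A]"] pairprod_sq[OF assms(1), of "y @ [B]"] assms(2)
    by (simp_all add: gterm_def power_mult_distrib)
qed

section \<open>Identities that depend on the cubic relation for c\<close>

locale param =
  fixes c \<zeta> s :: "'a::field"
  assumes cubic: "c ^ 3 + 2 * c ^ 2 + 2 * c + 2 = 0"
    and two_nonzero: "(2 :: 'a) \<noteq> 0"
    and zeta_sq: "\<zeta> ^ 2 = - 1"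
    and s_sq: "s ^ 2 = 2"
begin

lemma c_nonzero: "c \<noteq> 0"
  using cubic two_nonzero by auto

text \<open>The constant in the denominator of condition (ii) is thus nonzero along with
  \<open>c\<close>.\<close>

lemma q_eq: "2 * (c ^ 2 + c + 1) = - (c ^ 3)"
  using cubic by - (rule diff_0_eq, Groebner_Basis.algebra)

lemma q_nonzero: "c ^ 2 + c + 1 \<noteq> 0"
proof
  assume "c ^ 2 + c + 1 = 0"
  then show False using q_eq c_nonzero by simp
qed

lemma four_nonzero: "(4 :: 'a) \<noteq> 0"
proof -
  have "(4 :: 'a) = 2 * 2" by simp
  then show ?thesis using two_nonzero by (metis mult_eq_0_iff)
qed

lemma s_nonzero: "s \<noteq> 0"
  using s_sq two_nonzero by auto

lemma zeta_nonzero: "\<zeta> \<noteq> 0"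
  using zeta_sq by auto

text \<open>The squares of \<open>pairprod\<close> at the two children of \<open>x\<close> are c^2 +
  c - [xa] and c^2 + c + [xa]. So [xa] cancels, and 2c^3(c + 1) remains, which equals 4 by the cubic
  relation.\<close>

lemma Uval_sq_sum:
  assumes "rooted c n L" "length x + 3 \<le> n"
  shows "Uval c L A x ^ 2 + Uval c L B x ^ 2 = 4"
proof -
  have *: "pairprod L (x @ [A]) ^ 2 = c ^ 2 + c - L (x @ [A])"
    "pairprod L (x @ [B]) ^ 2 = c ^ 2 + c + L (x @ [A])"
    using pairprod_sq[OF assms(1), of "x @ [A]"] pairprod_sq[OF assms(1), of "x @ [B]"] assms
    by (simp_all add: rootedD)
  show ?thesis
    unfolding Uval_eq_pairprod using *[THEN eq_diff_0] cubic by - (rule diff_0_eq, Groebner_Basis.algebra)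
qed

lemma Uval_nonzero:
  assumes "rooted c n L" "length x + 3 \<le> n"
  shows "Uval c L l x \<noteq> 0"
  using assms by (simp add: Uval_eq_pairprod c_nonzero pairprod_nonzero)

text \<open>On this conic (2 + u + v)^2 = 2(2 + u)(2 + v), and neither coordinate can be -2 because
  the other would vanish.\<close>

lemma denom_nonzero:
  assumes "u ^ 2 + v ^ 2 = 4" "u \<noteq> 0" "v \<noteq> (0 :: 'a)"
  shows "2 + u + v \<noteq> 0" "2 + v \<noteq> 0"
proof -
  show *: "2 + v \<noteq> 0"
  proof
    assume "2 + v = 0"
    then have "v = - 2" by (simp add: eq_neg_iff_add_eq_0 add.commute)
    then show False using assms by simp
  qed
  have "2 + u \<noteq> 0"
  proof
    assume "2 + u = 0"
    then have "u = - 2" by (simp add: eq_neg_iff_add_eq_0 add.commute)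
    then show False using assms by simp
  qed
  moreover have "(2 + u + v) ^ 2 = 2 * (2 + u) * (2 + v)"
    using assms(1)[THEN eq_diff_0] by - (rule diff_0_eq, Groebner_Basis.algebra)
  ultimately show "2 + u + v \<noteq> 0"
    using * two_nonzero by (metis mult_eq_0_iff power_zero_numeral)
qed

text \<open>Regrouping turns T_a T_b into a left-hand side of condition (i) times one more
  \<open>pairprod\<close>. The condition at \<open>x @ [m]\<close> and then the one at
  \<open>x\<close> each contribute a factor zeta, and zeta^2 = -1.\<close>

lemma gterm_prod:
  assumes "zeta_at L \<zeta> x m" "zeta_at L \<zeta> (x @ [m]) l"
  shows "gterm L (x @ [m, l]) A * gterm L (x @ [m, l]) B = - pairprod L (x @ [other m])"
proof -
  have "gterm L (x @ [m, l]) A * gterm L (x @ [m, l]) B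
      = (pairprod L (x @ [m, l, A]) * pairprod L (x @ [m, l, B])) * pairprod L (x @ [m, l])"
    by (simp add: gterm_def pairprod_def)
  also have "\<dots> = \<zeta> * (pairprod L (x @ [m, other l]) * pairprod L (x @ [m, l]))"
    using assms(2) by (simp add: zeta_at_def)
  also have "pairprod L (x @ [m, other l]) * pairprod L (x @ [m, l])
      = \<zeta> * pairprod L (x @ [other m])"
    using assms(1) by (cases l) (simp_all add: zeta_at_def mult.commute)
  also have "\<zeta> * (\<zeta> * pairprod L (x @ [other m])) = \<zeta> ^ 2 * pairprod L (x @ [other m])"
    by (simp add: power2_eq_square)
  finally show ?thesis by (simp add: zeta_sq)
qed

text \<open>The product T_a T_b is the same number -h at both children of \<open>x @ [m]\<close>, so
  the squares of T_a + T_b there differ only in the sign of y, and their product is a difference of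
  squares. For the conjugate, (T_a + T_b)(T_a - T_b) = T_a^2 - T_b^2 is a multiple of u.\<close>

lemma
  assumes "rooted c n L" "length x + 5 \<le> n"
    and "zeta_at L \<zeta> x m" "\<And>l. zeta_at L \<zeta> (x @ [m]) l"
  shows twist2_sq: "twist2 L 0 x m ^ 2 = 8 * (c ^ 2 + c + 1) * (2 + Uval c L (other m) x)"
    and twist2_conj: "twist2 L 0 x m * twist2 L 1 x m = - 8 * (c ^ 2 + c + 1) * Uval c L m x"
proof -
  define a b where "a = gterm L (x @ [m, A]) A" and "b = gterm L (x @ [m, A]) B"
  define a' b' where "a' = gterm L (x @ [m, B]) A" and "b' = gterm L (x @ [m, B]) B"
  define u u' where "u = L (x @ [m, A, A])" and "u' = L (x @ [m, B, A])"
  define y h where "y = L (x @ [m, A])" and "h = pairprod L (x @ [other m])"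
  have ab: "a * b = - h" "a' * b' = - h"
    using gterm_prod[OF assms(3,4)] by (simp_all add: a_def b_def a'_def b'_def h_def)
  have sq: "a ^ 2 = (c ^ 2 + c - u) * (- u - c)" "b ^ 2 = (c ^ 2 + c + u) * (u - c)"
    "a' ^ 2 = (c ^ 2 + c - u') * (- u' - c)" "b' ^ 2 = (c ^ 2 + c + u') * (u' - c)"
    using gterm_sq[OF assms(1), of "x @ [m, A]"] gterm_sq[OF assms(1), of "x @ [m, B]"] assms(2)
    by (simp_all add: a_def b_def a'_def b'_def u_def u'_def)
  have uu: "u ^ 2 = y - c" "u' ^ 2 = - y - c" "y ^ 2 = L (x @ [m]) - c"
    using rootedD[OF assms(1), of "x @ [m, A]"] rootedD[OF assms(1), of "x @ [m, B]"]
      rootedD[OF assms(1), of "x @ [m]"] assms(2)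
    by (simp_all add: y_def u_def u'_def)
  have "L (x @ [other m]) = - L (x @ [m])"
    using rootedD[OF assms(1), of x] assms(2) by (cases m) simp_all
  then have h2: "h ^ 2 = c ^ 2 + c + L (x @ [m])"
    using pairprod_sq[OF assms(1), of "x @ [other m]"] assms(2) by (simp add: h_def)
  have sum: "(a + b) ^ 2 = 2 * (y + c ^ 2 + c + 2 - h)" "(a' + b') ^ 2 = 2 * (- y + c ^ 2 + c + 2 - h)"
    using ab[THEN eq_diff_0] sq[THEN eq_diff_0] uu[THEN eq_diff_0] cubic
    by - (rule diff_0_eq, Groebner_Basis.algebra)+
  have "twist2 L 0 x m ^ 2 = (a + b) ^ 2 * (a' + b') ^ 2"
    by (simp add: twist2_def twist_def a_def b_def a'_def b'_def power_mult_distrib)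
  also have "\<dots> = 4 * ((c ^ 2 + c + 2 - h) ^ 2 - y ^ 2)"
    unfolding sum by Groebner_Basis.algebra
  also have "\<dots> = 8 * (c ^ 2 + c + 1) * (2 + c * h)"
    unfolding uu using h2[THEN eq_diff_0] cubic by - (rule diff_0_eq, Groebner_Basis.algebra)
  finally show "twist2 L 0 x m ^ 2 = 8 * (c ^ 2 + c + 1) * (2 + Uval c L (other m) x)"
    by (simp add: Uval_eq_pairprod h_def)
  have diff: "(a + b) * (a - b) = - 2 * c ^ 2 * u" "(a' + b') * (a' - b') = - 2 * c ^ 2 * u'"
    using sq[THEN eq_diff_0] by - (rule diff_0_eq, Groebner_Basis.algebra)+
  have "twist2 L 0 x m * twist2 L 1 x m = ((a + b) * (a - b)) * ((a' + b') * (a' - b'))"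
    by (simp add: twist2_def twist_def a_def b_def a'_def b'_def)
  also have "\<dots> = - 8 * (c ^ 2 + c + 1) * (c * (u * u'))"
    unfolding diff using cubic by - (rule diff_0_eq, Groebner_Basis.algebra)
  finally show "twist2 L 0 x m * twist2 L 1 x m = - 8 * (c ^ 2 + c + 1) * Uval c L m x"
    by (simp add: Uval_eq_pairprod u_def u'_def pairprod_def)
qed

lemma twist2_nonzero:
  assumes "rooted c n L" "length x + 5 \<le> n"
    and "zeta_at L \<zeta> x m" "\<And>l. zeta_at L \<zeta> (x @ [m]) l"
  shows "twist2 L 0 x m \<noteq> 0"
proof -
  have "2 + Uval c L (other m) x \<noteq> 0"
    using denom_nonzero(2)[of "Uval c L m x" "Uval c L (other m) x"] Uval_sq_sum[OF assms(1), of x]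
      Uval_nonzero[OF assms(1), of x] assms(2)
    by (cases m) (simp_all add: add.commute)
  moreover have "(8 :: 'a) \<noteq> 0"
  proof -
    have "(8 :: 'a) = 2 * 4" by simp
    then show ?thesis using two_nonzero four_nonzero by (metis mult_eq_0_iff)
  qed
  ultimately have "twist2 L 0 x m ^ 2 \<noteq> 0"
    unfolding twist2_sq[OF assms] using q_nonzero by (metis mult_eq_0_iff)
  then show ?thesis by auto
qed

text \<open>The squares of both sides agree: with q = c^2 + c + 1, the left one is 64 q^2 (2 +
  U_a)(2 + U_b) by \<open>twist2_sq\<close>, and 2(2 + U_a)(2 + U_b) = (2 + U_a + U_b)^2.\<close>

lemma sqrt_at_or_neg:
  assumes "rooted c n L" "length x + 5 \<le> n"
    and "\<And>m. zeta_at L \<zeta> x m" "\<And>l m. zeta_at L \<zeta> (x @ [m]) l"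
  shows "sqrt_at c L s x \<or> sqrt_at c L (- s) x"
proof -
  have sq: "twist2 L 0 x A ^ 2 = 8 * (c ^ 2 + c + 1) * (2 + Uval c L B x)"
    "twist2 L 0 x B ^ 2 = 8 * (c ^ 2 + c + 1) * (2 + Uval c L A x)"
    "Uval c L A x ^ 2 + Uval c L B x ^ 2 = 4"
    using twist2_sq[OF assms(1-2), of A] twist2_sq[OF assms(1-2), of B] assms(2-4)
      Uval_sq_sum[OF assms(1), of x]
    by simp_all
  have "(twist2 L 0 x A * twist2 L 0 x B) ^ 2 =
      (4 * (c ^ 2 + c + 1) * (2 + Uval c L A x + Uval c L B x) * s) ^ 2"
    unfolding power_mult_distrib[of _ s] power_mult_distrib[of "twist2 L 0 x A"] sq(1,2) s_sq
    using sq(3)[THEN eq_diff_0] by - (rule diff_0_eq, Groebner_Basis.algebra)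
  then show ?thesis
    by (auto simp: sqrt_at_def power2_eq_iff)
qed

text \<open>Conjugating one half of the numerator of (ii) flips v, the U that occurs in g^2, and
  negates s. The reason is u(2 + u + v) = (2 + v)(2 + u - v) on the conic.\<close>

lemma twist_identity:
  fixes g g' h q u v :: 'a
  assumes "g ^ 2 = 8 * q * (2 + v)" "g * g' = - 8 * q * u"
    and "g * h = 4 * q * (2 + u + v) * s" "u ^ 2 + v ^ 2 = 4" "g \<noteq> 0"
  shows "g' * h = - (4 * q * (2 + u - v) * s)"
proof -
  have "g ^ 2 * (g' * h) = (g * g') * (g * h)"
    by (simp add: power2_eq_square ac_simps)
  also have "\<dots> = g ^ 2 * - (4 * q * (2 + u - v) * s)"
    unfolding assms(1-3) using assms(4)[THEN eq_diff_0]
    by - (rule diff_0_eq, Groebner_Basis.algebra)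
  finally show ?thesis
    using assms(5) by (metis mult_left_cancel power_not_zero)
qed

text \<open>The exponent is the logical "or" of the two bits: every nontrivial change of signs
  negates s. The indices are crossed because the square of \<open>twist2\<close> at \<open>m\<close>
  involves U at \<open>other m\<close>.\<close>

lemma sqrt_at_twist:
  assumes "rooted c n L" "length x + 5 \<le> n"
    and "\<And>m. zeta_at L \<zeta> x m" "\<And>l m. zeta_at L \<zeta> (x @ [m]) l"
    and "sqrt_at c L s x"
  shows "twist2 L (e (other m)) x m * twist2 L (e m) x (other m)
    = sign_of (e m + e (other m) + e m * e (other m)) * 4 * (c ^ 2 + c + 1) *
      (2 + sign_of (e m) * Uval c L m x + sign_of (e (other m)) * Uval c L (other m) x) * s"
proof -
  define u v where "u = Uval c L m x" and "v = Uval c L (other m) x"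
  define g h where "g = twist2 L 0 x m" and "h = twist2 L 0 x (other m)"
  define g' h' where "g' = twist2 L 1 x m" and "h' = twist2 L 1 x (other m)"
  define q where "q = c ^ 2 + c + 1"
  have uv: "u ^ 2 + v ^ 2 = 4" "u \<noteq> 0" "v \<noteq> 0"
    using Uval_sq_sum[OF assms(1), of x] Uval_nonzero[OF assms(1), of x] assms(2)
    by (cases m; simp add: u_def v_def add.commute)+
  have gh: "g ^ 2 = 8 * q * (2 + v)" "h ^ 2 = 8 * q * (2 + u)"
    "g * g' = - 8 * q * u" "h * h' = - 8 * q * v" "g \<noteq> 0" "h \<noteq> 0"
    using twist2_sq[OF assms(1-2), of m] twist2_sq[OF assms(1-2), of "other m"]
      twist2_conj[OF assms(1-2), of m] twist2_conj[OF assms(1-2), of "other m"]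
      twist2_nonzero[OF assms(1-2), of m] twist2_nonzero[OF assms(1-2), of "other m"] assms(2-4)
    by (simp_all add: u_def v_def g_def h_def g'_def h'_def q_def)
  have base: "g * h = 4 * q * (2 + u + v) * s"
    using assms(5) by (cases m) (simp_all add: sqrt_at_def u_def v_def g_def h_def q_def ac_simps)
  note 1 = twist_identity[OF gh(1,3) base uv(1) gh(5)]
  have base': "h * g = 4 * q * (2 + v + u) * s"
    using base by (simp only: ac_simps)
  have 2: "h' * g = - (4 * q * (2 + v - u) * s)"
    using twist_identity[OF gh(2,4) base' _ gh(6)] uv(1) by (simp only: add.commute)
  \<comment> \<open>When both halves are conjugated, (2 + u + v)(2 - u - v) = -2uv gives the
    product, and \<open>g * h\<close> can be cancelled.\<close>
  have "(g * h) * (g' * h') = (g * g') * (h * h')"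
    by (simp add: ac_simps)
  also have "\<dots> = (4 * q * (2 + u + v) * s) * - (4 * q * (2 - u - v) * s)"
    unfolding gh using uv(1)[THEN eq_diff_0] s_sq[THEN eq_diff_0]
    by - (rule diff_0_eq, Groebner_Basis.algebra)
  finally have 3: "g' * h' = - (4 * q * (2 - u - v) * s)"
    unfolding base[symmetric] using gh(5,6) by (metis mult_left_cancel mult_eq_0_iff)
  show ?thesis
  proof (cases "e m"; cases "e (other m)")
    assume "e m = 0" "e (other m) = 0"
    then show ?thesis using base by (simp add: u_def v_def g_def h_def q_def)
  next
    assume "e m = 0" "e (other m) = 1"
    then show ?thesis using 1 by (simp add: u_def v_def g'_def h_def q_def algebra_simps)
  next
    assume "e m = 1" "e (other m) = 0"
    then show ?thesis using 2 by (simp add: u_def v_def g_def h'_def q_def algebra_simps)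
  next
    assume "e m = 1" "e (other m) = 1"
    then show ?thesis using 3 by (simp add: u_def v_def g'_def h'_def q_def algebra_simps)
  qed
qed

end

subsection \<open>The action of a field homomorphism\<close>

lemma letter_UNIV: "(UNIV :: letter set) = {A, B}"
  using letter.exhaust by auto

lemma bit_add_self [simp]: "a + a = (0 :: bit)" "a + (a + b) = (b :: bit)"
  by (cases a; cases b; simp)+

lemma sign_of_mult_self [simp]: "sign_of e * sign_of e = 1"
  by (cases e) simp_all

text \<open>The action of a bit on the two children of a node; on labels it becomes multiplication
  by \<open>sign_of\<close>, see \<open>L_shift\<close>.\<close>

definition shift :: "bit \<Rightarrow> letter \<Rightarrow> letter" where
  "shift e l = (if e = 0 then l else other l)"

lemma shift_simps [simp]: "shift 0 l = l" "shift 1 l = other l" "shift e (shift e l) = l"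
  by (simp_all add: shift_def)

lemma shift_other: "shift e (other l) = other (shift e l)"
  by (simp add: shift_def)

text \<open>The exponent of the sign that \<sigma> puts in front of \<open>pairprod\<close> at
  \<open>z\<close>, see \<open>hom_pairprod\<close>.\<close>

definition Par2 :: "(word \<Rightarrow> word) \<Rightarrow> word \<Rightarrow> bit" where
  "Par2 g z = Par g (z @ [A]) + Par g (z @ [B])"

lemma P32_eq: "P32 g l x = Par2 g (x @ [l, A]) + Par2 g (x @ [l, B]) + Par2 g (x @ [other l])"
  by (simp add: P32_def Par2_def words_2[simplified] words_1[simplified] ac_simps)

text \<open>Sorting by the first letter matches the two halves of the numerator of condition
  (ii).\<close>

lemma R32_eq:
  "R32 g x = (\<Sum>m\<in>UNIV. \<Sum>l\<in>UNIV. Par g (x @ [m, l]) + Par g (x @ [m, l, B]) + Par2 g (x @ [m, l, A]))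
     + Par2 g (x @ [A]) * Par2 g (x @ [B])"
  by (simp add: R32_def Par2_def words_2[simplified] letter_UNIV ac_simps)

text \<open>A subfield given as a set, with a map constrained only on it, lets the tree computations
  use type class arithmetic instead of ring records.\<close>

locale field_hom_on =
  fixes F :: "'a::field set" and \<sigma> :: "'a \<Rightarrow> 'a"
  assumes one_closed: "1 \<in> F"
    and add_closed: "u \<in> F \<Longrightarrow> v \<in> F \<Longrightarrow> u + v \<in> F"
    and mult_closed: "u \<in> F \<Longrightarrow> v \<in> F \<Longrightarrow> u * v \<in> F"
    and minus_closed: "u \<in> F \<Longrightarrow> - u \<in> F"
    and inverse_closed: "u \<in> F \<Longrightarrow> inverse u \<in> F"
    and hom_one: "\<sigma> 1 = 1"
    and hom_add: "u \<in> F \<Longrightarrow> v \<in> F \<Longrightarrow> \<sigma> (u + v) = \<sigma> u + \<sigma> v"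
    and hom_mult: "u \<in> F \<Longrightarrow> v \<in> F \<Longrightarrow> \<sigma> (u * v) = \<sigma> u * \<sigma> v"
begin

lemma zero_closed: "0 \<in> F"
  using add_closed[OF one_closed minus_closed[OF one_closed]] by simp

lemma hom_zero: "\<sigma> 0 = 0"
  using hom_add[OF zero_closed zero_closed] by (metis add.right_neutral add_left_cancel)

lemma hom_minus: "u \<in> F \<Longrightarrow> \<sigma> (- u) = - \<sigma> u"
  using hom_add[of u "- u"] minus_closed[of u] hom_zero by (simp add: eq_neg_iff_add_eq_0 add.commute)

lemma diff_closed: "u \<in> F \<Longrightarrow> v \<in> F \<Longrightarrow> u - v \<in> F"
  using add_closed[of u "- v"] minus_closed[of v] by simp

lemma divide_closed: "u \<in> F \<Longrightarrow> v \<in> F \<Longrightarrow> u / v \<in> F"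
  by (simp add: divide_inverse inverse_closed mult_closed)

lemma power_closed: "u \<in> F \<Longrightarrow> u ^ n \<in> F"
  by (induction n) (simp_all add: one_closed mult_closed)

lemma hom_power: "u \<in> F \<Longrightarrow> \<sigma> (u ^ n) = \<sigma> u ^ n"
  by (induction n) (simp_all add: hom_one hom_mult power_closed)

lemma of_nat_closed: "of_nat n \<in> F"
  by (induction n) (simp_all add: zero_closed one_closed add_closed)

lemma hom_of_nat: "\<sigma> (of_nat n) = of_nat n"
  by (induction n) (simp_all add: hom_zero hom_one hom_add one_closed of_nat_closed)

lemma numeral_closed: "numeral n \<in> F"
  using of_nat_closed[of "numeral n"] by simp

lemma hom_numeral: "\<sigma> (numeral n) = numeral n"
  using hom_of_nat[of "numeral n"] by simp

lemma hom_nonzero: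
  assumes "u \<in> F" "u \<noteq> 0"
  shows "\<sigma> u \<noteq> 0"
proof
  assume "\<sigma> u = 0"
  moreover have "\<sigma> u * \<sigma> (inverse u) = 1"
    using hom_mult[of u "inverse u"] assms inverse_closed hom_one by simp
  ultimately show False by simp
qed

lemmas closed = zero_closed one_closed add_closed mult_closed minus_closed diff_closed inverse_closed
  divide_closed power_closed numeral_closed
lemmas hom = hom_zero hom_one hom_add hom_mult hom_minus hom_power hom_numeral

end

section \<open>The action on labels and on the two conditions\<close>

locale tree_hom = param c \<zeta> s + field_hom_on F \<sigma>
  for c \<zeta> s :: "'a::field" and F :: "'a set" and \<sigma> :: "'a \<Rightarrow> 'a" +
  fixes L :: "word \<Rightarrow> 'a" and g :: "word \<Rightarrow> word"
  assumes rooted: "\<And>n. rooted c n L"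
    and zeta_cond: "\<And>x l. zeta_at L \<zeta> x l"
    and sqrt_cond: "\<And>x. sqrt_at c L s x"
    and L_closed: "\<And>w. L w \<in> F"
    and c_closed: "c \<in> F"
    and hom_c: "\<sigma> c = c"
    and hom_L: "\<And>w. \<sigma> (L w) = L (g w)"
    and g_append: "\<And>w l. g (w @ [l]) = g w @ [shift (Par g w) l]"
begin

lemma L_shift: "L (w @ [shift e l]) = sign_of e * L (w @ [l])"
  using rootedD(2)[OF rooted, of w "Suc (length w)"] by (cases e; cases l) simp_all

lemma g_append2: "g (w @ [k, l]) = g w @ [shift (Par g w) k, shift (Par g (w @ [k])) l]"
  using g_append[of "w @ [k]" l] g_append[of w k] by simp

lemma L_shift': "L (w @ [k, shift e l]) = sign_of e * L (w @ [k, l])"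
  using L_shift[of "w @ [k]"] by simp

lemma pairprod_closed: "pairprod L z \<in> F"
  by (simp add: pairprod_def closed L_closed)

lemma pairprod_nz: "pairprod L z \<noteq> 0"
  using pairprod_nonzero[OF rooted le_refl] .

text \<open>A swap of the children of \<open>z\<close> merely exchanges the two factors, so only the
  swaps one level lower leave a sign.\<close>

lemma hom_pairprod: "\<sigma> (pairprod L z) = sign_of (Par2 g z) * pairprod L (g z)"
  unfolding pairprod_def hom_mult[OF L_closed L_closed] hom_L g_append2 L_shift'
  by (cases "Par g z") (simp_all add: Par2_def sign_of_add ac_simps)

lemma gterm_closed: "gterm L y l \<in> F"
  by (simp add: gterm_def closed L_closed pairprod_closed)

lemma hom_gterm:
  "\<sigma> (gterm L y l) = sign_of (Par2 g (y @ [l]) + Par g (y @ [other l]))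
     * gterm L (g y) (shift (Par g y) l)"
  unfolding gterm_def hom_mult[OF pairprod_closed L_closed] hom_pairprod hom_L
    g_append g_append2 L_shift' shift_other sign_of_add
  by (simp add: ac_simps)

text \<open>Condition (i) at the root writes zeta as a quotient of products of labels.
  \<open>s_closed\<close> uses (ii) in the same way.\<close>

lemma zeta_closed: "\<zeta> \<in> F"
proof -
  have "\<zeta> = pairprod L [A, A] * pairprod L [A, B] / pairprod L [B]"
    using zeta_cond[of "[]" A] pairprod_nz[of "[B]"] by (simp add: zeta_at_def)
  then show ?thesis by (simp add: closed pairprod_closed)
qed

text \<open>Apply \<sigma> to condition (i) at \<open>x\<close> and compare with (i) at
  \<open>g x\<close>, where the letter \<open>l\<close> has become \<open>l'\<close>. A swap below
  \<open>x @ [l]\<close> only exchanges the two factors on the left.\<close>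

lemma hom_zeta: "\<sigma> \<zeta> = sign_of (P32 g l x) * \<zeta>"
proof -
  define l' where "l' = shift (Par g x) l"
  define H where "H = pairprod L (g x @ [other l'])"
  have H: "H \<noteq> 0" by (simp add: H_def pairprod_nz)
  have gx: "g (x @ [l, k]) = (g x @ [l']) @ [shift (Par g (x @ [l])) k]" for k
    by (simp add: g_append2 l'_def)
  have "\<sigma> (pairprod L (x @ [l, A])) * \<sigma> (pairprod L (x @ [l, B]))
      = \<sigma> \<zeta> * \<sigma> (pairprod L (x @ [other l]))"
    using zeta_cond[of x l] unfolding zeta_at_def
    by (metis hom_mult pairprod_closed zeta_closed)
  also have "\<sigma> (pairprod L (x @ [other l])) = sign_of (Par2 g (x @ [other l])) * H"
    by (simp add: hom_pairprod g_append H_def l'_def shift_other)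
  also have "\<sigma> (pairprod L (x @ [l, A])) * \<sigma> (pairprod L (x @ [l, B]))
      = sign_of (Par2 g (x @ [l, A]) + Par2 g (x @ [l, B])) * (\<zeta> * H)"
    using zeta_cond[of "g x" l'] unfolding zeta_at_def hom_pairprod gx sign_of_add H_def[symmetric]
    by (cases "Par g (x @ [l])") (simp_all add: ac_simps)
  finally have "sign_of (Par2 g (x @ [l, A]) + Par2 g (x @ [l, B])) * \<zeta>
      = \<sigma> \<zeta> * sign_of (Par2 g (x @ [other l]))"
    using H by simp
  then show ?thesis
    unfolding P32_eq sign_of_add by (cases "Par2 g (x @ [other l])") simp_all
qed

text \<open>The sign is the quotient of \<sigma>(zeta) by zeta, which knows neither the node nor the
  letter.\<close>

lemma P32_const: "P32 g l x = P32 g l' x'"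
proof -
  have "sign_of (P32 g l x) = (sign_of (P32 g l' x') :: 'a)"
    using hom_zeta[of l x] hom_zeta[of l' x'] zeta_nonzero by simp
  then show ?thesis
    using sign_of_eq_iff[OF two_nonzero] by blast
qed

text \<open>The sign by which the two terms of \<open>\<gamma>\<close> at \<open>x m l\<close> are twisted relative to each other.\<close>

lemma Par2_sum:
  "Par2 g (x @ [m, l, A]) + Par2 g (x @ [m, l, B]) + Par2 g (x @ [m, l]) = Par2 g (x @ [other m])"
proof -
  have "P32 g l (x @ [m]) = P32 g m x" by (rule P32_const)
  then have "Par2 g (x @ [m, l, A]) + Par2 g (x @ [m, l, B]) + Par2 g (x @ [m, other l])
      = Par2 g (x @ [m, l]) + Par2 g (x @ [m, other l]) + Par2 g (x @ [other m])"
    unfolding P32_eq by (cases l) (simp_all add: ac_simps)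
  then show ?thesis
    by (cases "Par2 g (x @ [m, l])"; cases "Par2 g (x @ [m, other l])") (simp_all add: ac_simps)
qed

lemma twist_closed: "twist L e y \<in> F"
  by (cases e) (simp_all add: twist_def closed gterm_closed)

text \<open>The sign of the image of T_a is taken out; \<open>e\<close> is the sign of the other
  term relative to it. If \<open>g\<close> swaps the children of \<open>y\<close> and
  \<open>e = 1\<close>, the result is T_b - T_a, whence the term \<open>Par g y * e\<close>.\<close>

lemma hom_twist:
  assumes "e = Par2 g (y @ [A]) + Par2 g (y @ [B]) + Par2 g y"
  shows "\<sigma> (twist L 0 y)
    = sign_of (Par2 g (y @ [A]) + Par g (y @ [B]) + Par g y * e) * twist L e (g y)"
proof -
  have e: "sign_of (Par2 g (y @ [B]) + Par g (y @ [A]))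
      = (sign_of (Par2 g (y @ [A]) + Par g (y @ [B])) * sign_of e :: 'a)"
    unfolding assms by (simp add: Par2_def[of g y] ac_simps flip: sign_of_add)
  have "\<sigma> (twist L 0 y) = \<sigma> (gterm L y A) + \<sigma> (gterm L y B)"
    by (simp add: twist_def hom_add gterm_closed)
  also have "\<dots> = sign_of (Par2 g (y @ [A]) + Par g (y @ [B])) *
      (gterm L (g y) (shift (Par g y) A) + sign_of e * gterm L (g y) (shift (Par g y) B))"
    using e by (simp add: hom_gterm algebra_simps)
  also have "\<dots> = sign_of (Par2 g (y @ [A]) + Par g (y @ [B]) + Par g y * e) * twist L e (g y)"
    unfolding twist_def sign_of_add[of _ "Par g y * e"]
    by (cases "Par g y"; cases e) (simp_all add: algebra_simps)
  finally show ?thesis .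
qed

text \<open>By \<open>Par2_sum\<close> the relative sign is the same at both children of
  \<open>x @ [m]\<close>, so the swap terms of \<open>hom_twist\<close> add up to a single
  product.\<close>

lemma hom_twist2:
  "\<sigma> (twist2 L 0 x m) = sign_of ((\<Sum>l\<in>UNIV. Par2 g (x @ [m, l, A]) + Par g (x @ [m, l, B]))
     + Par2 g (x @ [m]) * Par2 g (x @ [other m]))
     * twist2 L (Par2 g (x @ [other m])) (g x) (shift (Par g x) m)"
proof -
  define h where "h = Par2 g (x @ [other m])"
  define T where "T k = twist L h (g x @ [shift (Par g x) m, k])" for k
  have *: "\<sigma> (twist L 0 (x @ [m, l])) = sign_of (Par2 g (x @ [m, l, A]) + Par g (x @ [m, l, B])
      + Par g (x @ [m, l]) * h) * T (shift (Par g (x @ [m])) l)" for l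
    using hom_twist[of h "x @ [m, l]"] Par2_sum[of x m l] by (simp add: h_def g_append2 T_def)
  have "\<sigma> (twist2 L 0 x m) = \<sigma> (twist L 0 (x @ [m, A])) * \<sigma> (twist L 0 (x @ [m, B]))"
    by (simp add: twist2_def hom_mult twist_closed)
  also have "\<dots> = sign_of ((\<Sum>l\<in>UNIV. Par2 g (x @ [m, l, A]) + Par g (x @ [m, l, B]))
     + Par2 g (x @ [m]) * h) * (T A * T B)"
    unfolding * Par2_def[of g "x @ [m]"]
    by (cases "Par g (x @ [m])") (simp_all add: letter_UNIV sign_of_add algebra_simps)
  finally show ?thesis
    by (simp add: twist2_def T_def h_def)
qed

lemma hom_Uval: "\<sigma> (Uval c L l x) = sign_of (Par2 g (x @ [l])) * Uval c L (shift (Par g x) l) (g x)"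
  by (simp add: Uval_eq_pairprod hom_mult c_closed pairprod_closed hom_c hom_pairprod g_append)

lemma Uval_closed: "Uval c L l x \<in> F"
  by (simp add: Uval_eq_pairprod closed c_closed pairprod_closed)

lemma twist2_closed: "twist2 L e x m \<in> F"
  by (simp add: twist2_def closed twist_closed)

lemma denominator:
  defines "D \<equiv> \<lambda>x. 4 * (c ^ 2 + c + 1) * (2 + Uval c L A x + Uval c L B x)"
  shows "D x \<in> F" "D x \<noteq> 0"
proof -
  show "D x \<in> F" by (simp add: D_def closed c_closed Uval_closed)
  have "2 + Uval c L A x + Uval c L B x \<noteq> 0"
    using denom_nonzero(1) Uval_sq_sum[OF rooted le_refl] Uval_nonzero[OF rooted le_refl] by blast
  then show "D x \<noteq> 0"
    unfolding D_def using q_nonzero four_nonzero by (metis mult_eq_0_iff)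
qed

lemma s_closed: "s \<in> F"
proof -
  define D where "D = 4 * (c ^ 2 + c + 1) * (2 + Uval c L A [] + Uval c L B [])"
  note D = denominator[of "[]", folded D_def]
  have "twist2 L 0 [] A * twist2 L 0 [] B = D * s"
    using sqrt_cond[of "[]"] unfolding sqrt_at_def D_def .
  then have "s = twist2 L 0 [] A * twist2 L 0 [] B / D"
    using D by simp
  then show ?thesis using D by (simp add: closed twist2_closed)
qed

text \<open>Apply \<sigma> to condition (ii) at \<open>x\<close>. By \<open>sqrt_at_twist\<close> at
  \<open>g x\<close>, the twisted numerator is again a sign times the image of the denominator times
  s.\<close>

lemma hom_sqrt: "\<sigma> s = sign_of (R32 g x) * s"
proof -
  define D where "D = 4 * (c ^ 2 + c + 1) * (2 + Uval c L A x + Uval c L B x)"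
  note D = denominator[of x, folded D_def]
  define h where "h = (\<lambda>k. Par2 g (x @ [k]))"
  define S where "S = (\<lambda>m. \<Sum>l\<in>UNIV. Par2 g (x @ [m, l, A]) + Par g (x @ [m, l, B]))"
  define m where "m = shift (Par g x) A"
  \<comment> \<open>\<open>e\<close> is indexed by letters below \<open>g x\<close>; as
    \<open>shift\<close> is an involution, the letter \<open>k\<close> there comes from
    \<open>shift (Par g x) k\<close> below \<open>x\<close>.\<close>
  define e where "e = (\<lambda>k. h (shift (Par g x) k))"
  have e: "e m = h A" "e (other m) = h B"
    by (simp_all add: e_def m_def shift_other)
  have m': "shift (Par g x) B = other m"
    using shift_other[of _ A] by (simp add: m_def)
  have "D * s = twist2 L 0 x A * twist2 L 0 x B"
    using sqrt_cond[of x] unfolding sqrt_at_def D_def by simp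
  then have "\<sigma> D * \<sigma> s = \<sigma> (twist2 L 0 x A) * \<sigma> (twist2 L 0 x B)"
    by (metis hom_mult D(1) s_closed twist2_closed)
  also have "\<dots> = sign_of (S A + h A * h B) * sign_of (S B + h A * h B) *
      (twist2 L (e (other m)) (g x) m * twist2 L (e m) (g x) (other m))"
    unfolding hom_twist2 e m' S_def h_def m_def[symmetric] by (simp add: ac_simps)
  also have "twist2 L (e (other m)) (g x) m * twist2 L (e m) (g x) (other m)
      = sign_of (h A + h B + h A * h B) * \<sigma> D * s"
  proof -
    have "\<sigma> D = 4 * (c ^ 2 + c + 1) *
        (2 + sign_of (h A) * Uval c L m (g x) + sign_of (h B) * Uval c L (other m) (g x))"
      by (simp add: D_def hom closed c_closed hom_c Uval_closed hom_Uval h_def m_def m'[unfolded m_def])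
    then show ?thesis
      using sqrt_at_twist[OF rooted le_refl zeta_cond zeta_cond sqrt_cond, of e m "g x"]
      unfolding e by (simp only: mult.assoc)
  qed
  \<comment> \<open>The product \<open>h A * h B\<close> occurs once in each half of the numerator
    and once through \<open>sqrt_at_twist\<close>, so one copy survives mod 2.\<close>
  also have "sign_of (S A + h A * h B) * sign_of (S B + h A * h B)
      * (sign_of (h A + h B + h A * h B) * \<sigma> D * s)
      = \<sigma> D * (sign_of (S A + S B + h A + h B + h A * h B) * s)"
    by (simp add: sign_of_add ac_simps)
  also have "S A + S B + h A + h B + h A * h B = R32 g x"
    by (simp add: R32_eq S_def h_def letter_UNIV Par2_def[of g "x @ [A]"] Par2_def[of g "x @ [B]"]
        ac_simps)
  finally show ?thesis
    using hom_nonzero[OF D] by simp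
qed

end

subsection \<open>Existence of the labeling\<close>

lemma rooted_iter:
  assumes "rooted c n L" "length w \<le> n"
  shows "(quad c ^^ length w) (L w) = L []"
  using assms(2)
proof (induction w rule: rev_induct)
  case (snoc l w)
  have "quad c (L (w @ [l])) = L w"
    using snoc.prems rootedD[OF assms(1), of w] by (cases l) (simp_all add: quad_def)
  then show ?case
    using snoc by (simp add: funpow_Suc_right del: funpow.simps)
qed simp

context param
begin

text \<open>With u = [xla], the square on the left is (c^2 + c)^2 - u^2 = f^3(0) - [xl], and the one
  on the right is -(f^2(0) + [xl]). They agree because f^3(0) = -f^2(0).\<close>

lemma zeta_at_or_neg:
  assumes "rooted c n L" "length x + 4 \<le> n"
  shows "zeta_at L \<zeta> x l \<or> zeta_at L (- \<zeta>) x l"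
proof -
  define u where "u = L (x @ [l, A])"
  have *: "L (x @ [l, B]) = - u" "u ^ 2 = L (x @ [l]) - c" "L (x @ [other l]) = - L (x @ [l])"
    using rootedD[OF assms(1), of "x @ [l]"] rootedD[OF assms(1), of x] assms(2)
    by (cases l; simp add: u_def)+
  have sq: "pairprod L (x @ [l, A]) ^ 2 = c ^ 2 + c - u" "pairprod L (x @ [l, B]) ^ 2 = c ^ 2 + c + u"
    "pairprod L (x @ [other l]) ^ 2 = c ^ 2 + c + L (x @ [l])"
    using pairprod_sq[OF assms(1), of "x @ [l, A]"] pairprod_sq[OF assms(1), of "x @ [l, B]"]
      pairprod_sq[OF assms(1), of "x @ [other l]"] assms(2) *
    by (simp_all add: u_def)
  have "(pairprod L (x @ [l, A]) * pairprod L (x @ [l, B])) ^ 2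
      = (\<zeta> * pairprod L (x @ [other l])) ^ 2"
    unfolding power_mult_distrib sq zeta_sq using *(2)[THEN eq_diff_0] cubic
    by - (rule diff_0_eq, Groebner_Basis.algebra)
  then show ?thesis
    by (auto simp: zeta_at_def power2_eq_iff)
qed

end

section \<open>Partial labelings and sign changes on their last level\<close>

definition agree :: "nat \<Rightarrow> (word \<Rightarrow> 'a) \<Rightarrow> (word \<Rightarrow> 'a) \<Rightarrow> bool" where
  "agree n L L' \<longleftrightarrow> (\<forall>w. length w \<le> n \<longrightarrow> L w = L' w)"

lemma agreeD: "agree n L L' \<Longrightarrow> length w \<le> n \<Longrightarrow> L w = L' w"
  by (simp add: agree_def)

lemma zeta_at_cong:
  assumes "agree n L L'" "length x + 4 \<le> n"
  shows "zeta_at L \<zeta> x l \<longleftrightarrow> zeta_at L' \<zeta> x l"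
  using assms by (simp add: zeta_at_def pairprod_def agreeD)

lemma sqrt_at_cong:
  assumes "agree n L L'" "length x + 5 \<le> n"
  shows "sqrt_at c L s x \<longleftrightarrow> sqrt_at c L' s x"
  using assms
  by (simp add: sqrt_at_def twist2_def twist_def gterm_def Uval_def pairprod_def agreeD)

lemma rooted_cong:
  assumes "agree n L L'"
  shows "rooted c n L \<longleftrightarrow> rooted c n L'"
  using assms by (simp add: rooted_def agreeD)

text \<open>Siblings are negated together, which keeps them opposite and preserves their
  squares.\<close>

definition flip_level :: "nat \<Rightarrow> word set \<Rightarrow> (word \<Rightarrow> 'a::field) \<Rightarrow> word \<Rightarrow> 'a" where
  "flip_level n S L w = (if length w = Suc n \<and> butlast w \<in> S then - L w else L w)"

lemma agree_flip_level: "agree n (flip_level n S L) L"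
  by (simp add: agree_def flip_level_def)

lemma flip_level_snoc:
  "flip_level n S L (u @ [l]) = (if length u = n \<and> u \<in> S then - L (u @ [l]) else L (u @ [l]))"
  by (simp add: flip_level_def)

lemma rooted_flip_level:
  assumes "rooted c (Suc n) L"
  shows "rooted c (Suc n) (flip_level n S L)"
  using assms unfolding rooted_def flip_level_snoc
  by (auto simp: flip_level_def)

lemma pairprod_flip_level:
  "length z + 2 = Suc n \<Longrightarrow> pairprod (flip_level n S L) z =
     (if z @ [A] \<in> S then - 1 else 1) * (if z @ [B] \<in> S then - 1 else 1) * pairprod L z"
  "length z + 2 \<le> n \<Longrightarrow> pairprod (flip_level n S L) z = pairprod L z"
  using flip_level_snoc[of n S L "z @ [A]" A] flip_level_snoc[of n S L "z @ [B]" A]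
  by (simp_all add: pairprod_def)

text \<open>The bounds 4 and 5 admit exactly the nodes whose conditions involve no label beyond
  level \<open>n\<close>.\<close>

definition admissible :: "'a::field \<Rightarrow> 'a \<Rightarrow> 'a \<Rightarrow> 'a \<Rightarrow> nat \<Rightarrow> (word \<Rightarrow> 'a) \<Rightarrow> bool" where
  "admissible c \<zeta> s x0 n L \<longleftrightarrow> L [] = x0 \<and> rooted c n L \<and>
     (\<forall>x l. length x + 4 \<le> n \<longrightarrow> zeta_at L \<zeta> x l) \<and>
     (\<forall>x. length x + 5 \<le> n \<longrightarrow> sqrt_at c L s x)"

lemma rooted_extend:
  fixes c :: "'a::alg_closed_field"
  assumes "rooted c n L" "\<And>i. L [] \<noteq> (quad c ^^ i) 0"
  obtains L' where "agree n L' L" "rooted c (Suc n) L'"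
proof -
  have "\<exists>r. r ^ 2 = L w - c" for w
    using nth_root_exists[of 2 "L w - c"] by simp
  then obtain \<rho> where \<rho>: "\<And>w. \<rho> w ^ 2 = L w - c"
    by metis
  define L' where "L' w = (if length w = Suc n then (if last w = A then 1 else - 1) * \<rho> (butlast w)
    else L w)" for w
  have agree: "agree n L' L"
    by (simp add: agree_def L'_def)
  \<comment> \<open>A vanishing square root would make the root of the tree equal to
    f^(n+1)(0).\<close>
  have nz: "\<rho> w \<noteq> 0" if "length w = n" for w
  proof
    assume "\<rho> w = 0"
    then have "L w = quad c 0"
      using \<rho>[of w] by (simp add: quad_def)
    then have "(quad c ^^ Suc n) 0 = L []"
      using rooted_iter[OF assms(1), of w] that by (simp add: funpow_Suc_right del: funpow.simps)
    then show False using assms(2) by metis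
  qed
  have "L' w \<noteq> 0" if "length w \<le> Suc n" for w
    using that nz[of "butlast w"] rooted_nonzero[OF assms(1), of w]
    by (cases "length w = Suc n") (simp_all add: L'_def)
  moreover have "L' (w @ [A]) ^ 2 = L' w - c \<and> L' (w @ [B]) = - L' (w @ [A])"
    if "length w < Suc n" for w
    using that rootedD[OF assms(1), of w] \<rho>[of w] by (cases "length w = n") (simp_all add: L'_def)
  ultimately have "rooted c (Suc n) L'"
    by (simp add: rooted_def)
  then show ?thesis using agree that by blast
qed

lemma agree_trans: "agree n L L' \<Longrightarrow> agree n L' L'' \<Longrightarrow> agree n L L''"
  by (simp add: agree_def)

context param
begin

text \<open>Negating the pair below \<open>x @ [l, A, A]\<close> changes one factor on the left of
  the condition for \<open>x\<close> and \<open>l\<close>. The right-hand side lies one level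
  higher, and distinct choices of \<open>x\<close> and \<open>l\<close> use distinct pairs.\<close>

lemma fix_zeta:
  assumes "rooted c (Suc n) L"
  obtains L' where "agree n L' L" "rooted c (Suc n) L'"
    "\<And>x l. length x + 4 = Suc n \<Longrightarrow> zeta_at L' \<zeta> x l"
proof -
  define S where "S = {x @ [l, A, A] |x l. \<not> zeta_at L \<zeta> x l}"
  have S: "x @ [l, A, A] \<in> S \<longleftrightarrow> \<not> zeta_at L \<zeta> x l" "x @ [l, A, B] \<notin> S" "x @ [l, B, k] \<notin> S" for x l k
    by (auto simp: S_def)
  have "zeta_at (flip_level n S L) \<zeta> x l" if "length x + 4 = Suc n" for x l
    using zeta_at_or_neg[OF assms(1), of x l] that
    by (cases "zeta_at L \<zeta> x l") (simp_all add: zeta_at_def pairprod_flip_level S)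
  then show ?thesis
    using that[OF agree_flip_level rooted_flip_level[OF assms]] by blast
qed

text \<open>At a bad node two pairs are negated, one under each child of \<open>x @ [A, A]\<close>.
  Both terms of gamma_aa change sign, hence so does the numerator of (ii), whereas in condition (i)
  the two changes cancel.\<close>

lemma fix_sqrt:
  assumes "rooted c (Suc n) L" "\<And>x l. length x + 4 \<le> Suc n \<Longrightarrow> zeta_at L \<zeta> x l"
  obtains L' where "agree n L' L" "rooted c (Suc n) L'"
    "\<And>x l. length x + 4 = Suc n \<Longrightarrow> zeta_at L' \<zeta> x l"
    "\<And>x. length x + 5 = Suc n \<Longrightarrow> sqrt_at c L' s x"
proof -
  define S where "S = {x @ [A, A, k, A] |x k. \<not> sqrt_at c L s x}"
  define L' where "L' = flip_level n S L"
  have S: "x @ [l, m, k, j] \<in> S \<longleftrightarrow> l = A \<and> m = A \<and> j = A \<and> \<not> sqrt_at c L s x" for x l m k j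
    by (auto simp: S_def)
  have S2: "z @ [k, A] \<in> S \<longleftrightarrow> z @ [A, A] \<in> S" "z @ [k, B] \<notin> S" for z k
    by (auto simp: S_def)
  have "zeta_at L' \<zeta> x l" if "length x + 4 = Suc n" for x l
    using assms(2)[of x l] that S2(1)[of "x @ [l]" B] S2(2)[of "x @ [l]"]
    by (simp add: zeta_at_def pairprod_flip_level L'_def)
  moreover have "sqrt_at c L' s x" if "length x + 5 = Suc n" for x
  proof -
    define e :: 'a where "e = (if sqrt_at c L s x then 1 else - 1)"
    have len: "length x + 4 = n" using that by simp
    have L': "L' (x @ [j, k, l, m]) = L (x @ [j, k, l, m])" for j k l m
      using len by (simp add: L'_def flip_level_def)
    have L'3: "L' (x @ [j, k, l]) = L (x @ [j, k, l])" for j k l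
      using len by (simp add: L'_def flip_level_def)
    have pair: "pairprod L' (x @ [l, m, k]) = (if l = A \<and> m = A then e else 1) * pairprod L (x @ [l, m, k])"
      for l m k
      using len by (simp add: L'_def pairprod_flip_level S e_def)
    have "twist2 L' 0 x A = e * twist2 L 0 x A" "twist2 L' 0 x B = twist2 L 0 x B"
      by (simp_all add: twist2_def twist_def gterm_def pair L' algebra_simps)
    moreover have "Uval c L' l x = Uval c L l x" for l
      by (simp add: Uval_def L'3)
    moreover have "sqrt_at c L s x \<or> sqrt_at c L (- s) x"
      using sqrt_at_or_neg[OF assms(1), of x] assms(2) that by simp
    ultimately show ?thesis
      by (cases "sqrt_at c L s x") (simp_all add: sqrt_at_def e_def)
  qed
  moreover have "agree n L' L" "rooted c (Suc n) L'"
    using agree_flip_level rooted_flip_level[OF assms(1)] unfolding L'_def by blast+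
  ultimately show ?thesis using that[of L'] by blast
qed

end

text \<open>The order of the repairs matters: \<open>sqrt_at_or_neg\<close> presupposes (i) down to
  the new level, and the repair of (ii) preserves (i).\<close>

lemma admissible_extend:
  fixes c \<zeta> s x0 :: "'a::alg_closed_field"
  assumes "param c \<zeta> s" and orbit: "\<And>i. x0 \<noteq> (quad c ^^ i) 0" and L: "admissible c \<zeta> s x0 n L"
  shows "\<exists>L'. admissible c \<zeta> s x0 (Suc n) L' \<and> agree n L' L"
proof -
  interpret param c \<zeta> s by fact
  obtain L0 where L0: "agree n L0 L" "rooted c (Suc n) L0"
    using rooted_extend[of c n L] L orbit by (auto simp: admissible_def)
  obtain L1 where L1: "agree n L1 L0" "rooted c (Suc n) L1"
    "\<And>x l. length x + 4 = Suc n \<Longrightarrow> zeta_at L1 \<zeta> x l"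
    using fix_zeta[OF L0(2)] by blast
  have L1L: "agree n L1 L" using agree_trans L1(1) L0(1) by blast
  have "zeta_at L1 \<zeta> x l" if "length x + 4 \<le> Suc n" for x l
    using L1(3) zeta_at_cong[OF L1L] L that by (cases "length x + 4 = Suc n") (simp_all add: admissible_def)
  then obtain L2 where L2: "agree n L2 L1" "rooted c (Suc n) L2"
    "\<And>x l. length x + 4 = Suc n \<Longrightarrow> zeta_at L2 \<zeta> x l"
    "\<And>x. length x + 5 = Suc n \<Longrightarrow> sqrt_at c L2 s x"
    using fix_sqrt[OF L1(2)] by blast
  have L2L: "agree n L2 L" using agree_trans L2(1) L1L by blast
  have "zeta_at L2 \<zeta> x l" if "length x + 4 \<le> Suc n" for x l
    using L2(3) zeta_at_cong[OF L2L] L that by (cases "length x + 4 = Suc n") (simp_all add: admissible_def)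
  moreover have "sqrt_at c L2 s x" if "length x + 5 \<le> Suc n" for x
    using L2(4) sqrt_at_cong[OF L2L] L that by (cases "length x + 5 = Suc n") (simp_all add: admissible_def)
  moreover have "L2 [] = x0"
    using agreeD[OF L2L, of "[]"] L by (simp add: admissible_def)
  ultimately have "admissible c \<zeta> s x0 (Suc n) L2"
    using L2(2) by (simp add: admissible_def)
  then show ?thesis using L2L by blast
qed

lemma admissible_exists:
  fixes c \<zeta> s x0 :: "'a::alg_closed_field"
  assumes "param c \<zeta> s" "\<And>i. x0 \<noteq> (quad c ^^ i) 0"
  obtains L where "\<And>n. admissible c \<zeta> s x0 n L"
proof -
  have "admissible c \<zeta> s x0 0 (\<lambda>_. x0)"
    using assms(2)[of 0] by (simp add: admissible_def rooted_def)
  then have "\<exists>L. admissible c \<zeta> s x0 0 L" by blast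
  from dependent_nat_choice[of "admissible c \<zeta> s x0" "\<lambda>n L L'. agree n L' L", OF this
      admissible_extend[OF assms]]
  obtain F where F: "\<And>n. admissible c \<zeta> s x0 n (F n)" "\<And>n. agree n (F (Suc n)) (F n)"
    by auto
  have F_le: "F n w = F (length w) w" if "length w \<le> n" for n w
    using that
  proof (induction n rule: dec_induct)
    case (step n)
    then show ?case using agreeD[OF F(2)[of n], of w] by metis
  qed simp
  \<comment> \<open>The label of \<open>w\<close> is final from stage \<open>length w\<close> on, so
    the diagonal agrees with every stage.\<close>
  define L where "L w = F (length w) w" for w
  have agree: "agree n L (F n)" for n
    unfolding agree_def L_def using F_le by metis
  have "admissible c \<zeta> s x0 n L" for n
    using F(1)[of n] agreeD[OF agree[of n], of "[]"]
    by (simp add: admissible_def rooted_cong[OF agree[of n]] zeta_at_cong[OF agree[of n]]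
        sqrt_at_cong[OF agree[of n]])
  then show ?thesis using that by blast
qed

subsection \<open>Labelings and the Galois group\<close>

text \<open>Equal labels have equal images under f, so the parents coincide by induction; siblings
  are opposite and nonzero, hence distinct when 2 is nonzero.\<close>

lemma labeling_inj:
  fixes L :: "word \<Rightarrow> 'a::field"
  assumes "\<And>n. rooted c n L" "(2 :: 'a) \<noteq> 0" "L u = L v" "length u = length v"
  shows "u = v"
  using assms(3,4)
proof (induction u arbitrary: v rule: rev_induct)
  case (snoc k u)
  then obtain v' l where v: "v = v' @ [l]"
    by (metis length_0_conv append_is_Nil_conv not_Cons_self2 rev_exhaust)
  have sq: "L (w @ [j]) ^ 2 = L w - c" for w j
    using rootedD[OF assms(1), of w "Suc (length w)"] by (cases j) simp_all
  have "L u = L v'"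
    using sq[of u k] sq[of v' l] snoc.prems v by simp
  then have "u = v'"
    using snoc v by simp
  moreover have "L (u @ [B]) \<noteq> L (u @ [A])"
  proof
    assume "L (u @ [B]) = L (u @ [A])"
    moreover have "L (u @ [B]) = - L (u @ [A])"
      using rootedD[OF assms(1), of u "Suc (length u)"] by simp
    ultimately have "2 * L (u @ [A]) = 0"
      by (metis add.right_inverse mult_2)
    then show False
      using assms(2) rooted_nonzero[OF assms(1) le_refl] by (metis mult_eq_0_iff)
  qed
  ultimately show ?case
    using snoc.prems(1) v by (cases k; cases l) auto
qed simp

lemma fibre_eq:
  assumes "\<And>n. rooted c n L"
  shows "{z. quad c z = L w} = {L (w @ [A]), L (w @ [B])}"
proof -
  have *: "L (w @ [A]) ^ 2 = L w - c" "L (w @ [B]) = - L (w @ [A])"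
    using rootedD[OF assms, of w "Suc (length w)"] by simp_all
  have "quad c z = L w \<longleftrightarrow> z ^ 2 = L (w @ [A]) ^ 2" for z
    by (auto simp: quad_def * eq_diff_eq)
  then show ?thesis
    by (auto simp: power2_eq_iff *(2))
qed

lemma preimages_eq:
  assumes "\<And>n. rooted c n L"
  shows "{z. (quad c ^^ n) z = L []} = L ` words n"
proof
  show "L ` words n \<subseteq> {z. (quad c ^^ n) z = L []}"
    using rooted_iter[OF assms le_refl] by (auto simp: words_def)
  show "{z. (quad c ^^ n) z = L []} \<subseteq> L ` words n"
  proof (induction n)
    case (Suc n)
    show ?case
    proof
      fix z assume "z \<in> {z. (quad c ^^ Suc n) z = L []}"
      then have "quad c z \<in> L ` words n"
        using Suc by (auto simp: funpow_Suc_right simp del: funpow.simps)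
      then obtain w where w: "length w = n" "quad c z = L w"
        by (auto simp: words_def)
      then have "z \<in> {L (w @ [A]), L (w @ [B])}"
        using fibre_eq[OF assms, of w] by blast
      then show "z \<in> L ` words (Suc n)"
        using w(1) by (auto simp: words_def)
    qed
  qed (simp add: words_def)
qed

text \<open>Forwards, a vanishing label would put x0 on the critical orbit. Backwards, bijectivity
  on each level combines \<open>labeling_inj\<close> with \<open>preimages_eq\<close>.\<close>

lemma labeling_iff_rooted:
  fixes c x0 :: "'k::field"
  assumes two: "(2 :: 'k alg_closure) \<noteq> 0" and orbit: "\<And>i. x0 \<noteq> (quad c ^^ i) 0"
  shows "labeling c x0 lab \<longleftrightarrow> lab [] = to_ac x0 \<and> (\<forall>n. rooted (to_ac c) n lab)"
proof
  assume lab: "labeling c x0 lab"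
  have orbit': "(quad (to_ac c) ^^ i) 0 = to_ac ((quad c ^^ i) 0)" for i
    by (induction i) (simp_all add: quad_def)
  have "lab w \<noteq> 0" for w
  proof
    assume "lab w = 0"
    moreover have "(quad (to_ac c) ^^ length w) (lab w) = to_ac x0"
      using lab by (auto simp: labeling_def bij_betw_def preimages_def words_def)
    ultimately show False
      using orbit' orbit by (metis to_ac_eq_iff)
  qed
  moreover have "lab (w @ [A]) ^ 2 = lab w - to_ac c \<and> lab (w @ [B]) = - lab (w @ [A])" for w
  proof -
    have "{z. quad (to_ac c) z = lab w} = {lab (w @ [A]), lab (w @ [B])}"
      using lab by (simp add: labeling_def)
    then have "quad (to_ac c) (lab (w @ [A])) = lab w" by blast
    then have "lab (w @ [A]) ^ 2 = lab w - to_ac c"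
      by (simp add: quad_def eq_diff_eq)
    then show ?thesis
      using lab by (simp add: labeling_def)
  qed
  ultimately show "lab [] = to_ac x0 \<and> (\<forall>n. rooted (to_ac c) n lab)"
    using lab by (simp add: labeling_def rooted_def)
next
  assume lab: "lab [] = to_ac x0 \<and> (\<forall>n. rooted (to_ac c) n lab)"
  then have rooted: "\<And>n. rooted (to_ac c) n lab" by blast
  have "bij_betw lab (words n) (preimages c x0 n)" for n
    using labeling_inj[OF rooted two] preimages_eq[OF rooted, of n] lab
    by (auto simp: bij_betw_def preimages_def inj_on_def words_def)
  moreover have "lab (w @ [B]) = - lab (w @ [A])" for w
    using rootedD(2)[OF rooted, of w "Suc (length w)"] by simp
  ultimately show "labeling c x0 lab"
    using lab fibre_eq[OF rooted] by (simp add: labeling_def)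
qed

lemma (in param) zeta4_condition_iff:
  assumes "\<And>n. rooted c n L"
  shows "zeta4_condition L \<zeta> \<longleftrightarrow> (\<forall>x l. zeta_at L \<zeta> x l)"
proof -
  have nz: "pairprod L z \<noteq> 0" for z
    using pairprod_nonzero[OF assms le_refl] .
  have prods: "(\<Prod>w\<in>words 2. L (x @ [l] @ w @ [A])) = pairprod L (x @ [l, A]) * pairprod L (x @ [l, B])"
    "(\<Prod>w\<in>words 1. L (x @ [l] @ w @ [A])) = pairprod L (x @ [l])" for x l
    by (simp_all add: words_2[simplified] words_1[simplified] pairprod_def ac_simps)
  have "(\<forall>l. zeta_at L \<zeta> x l) \<longleftrightarrow> zeta_at L \<zeta> x A \<and> zeta_at L \<zeta> x B" for x
    by (metis letter.exhaust)
  then show ?thesis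
    unfolding zeta4_condition_def prods zeta_at_def
    by (simp add: nonzero_divide_eq_eq nz)
qed

lemma (in param) sqrt2_condition_iff:
  assumes "\<And>n. rooted c n L"
  shows "sqrt2_condition c L s \<longleftrightarrow> (\<forall>x. sqrt_at c L s x)"
proof -
  have nz: "4 * (c ^ 2 + c + 1) * (2 + Uval c L A x + Uval c L B x) \<noteq> 0" for x
  proof -
    have "2 + Uval c L A x + Uval c L B x \<noteq> 0"
      using denom_nonzero(1) Uval_sq_sum[OF assms le_refl] Uval_nonzero[OF assms le_refl] by blast
    then show ?thesis
      using q_nonzero four_nonzero by (metis mult_eq_0_iff)
  qed
  then show ?thesis
    unfolding sqrt2_condition_def sqrt_at_def twist2_def gam_eq_twist nonzero_divide_eq_eq[OF nz]
    by (simp only: ac_simps)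
qed

text \<open>The sum f^3(0) + f^2(0) factors as c(c^3 + 2c^2 + 2c + 2), and c = f(0) is nonzero
  because 0 is not a fixed point.\<close>

lemma param_of_postcritical:
  fixes c :: "'k::field" and \<zeta>4 sqrt2 :: "'k alg_closure"
  assumes "CHAR('k) \<noteq> 2" "strictly_preperiodic (quad c) 0" "minimal_opposite (quad c) 3 2"
    and "sqrt2 ^ 2 = 2" "primitive_root_of_unity 4 \<zeta>4"
  shows "param (to_ac c) \<zeta>4 sqrt2"
proof
  have c: "c \<noteq> 0"
  proof -
    have "\<forall>n>0. (quad c ^^ n) 0 \<noteq> 0"
      using assms(2) by (simp add: strictly_preperiodic_def)
    from this[rule_format, of 1] show ?thesis by (auto simp: quad_def)
  qed
  have "(quad c ^^ 3) 0 = - (quad c ^^ 2) 0"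
    using assms(3) by (simp add: minimal_opposite_def)
  moreover have "(quad c ^^ 3) 0 = (c ^ 2 + c) ^ 2 + c" "(quad c ^^ 2) 0 = c ^ 2 + c"
    by (simp_all add: numeral_eq_Suc quad_def)
  ultimately have "((c ^ 2 + c) ^ 2 + c) - - (c ^ 2 + c) = 0"
    by (simp only: right_minus_eq)
  moreover have "((c ^ 2 + c) ^ 2 + c) - - (c ^ 2 + c) = c * (c ^ 3 + 2 * c ^ 2 + 2 * c + 2)"
    by Groebner_Basis.algebra
  ultimately have "c ^ 3 + 2 * c ^ 2 + 2 * c + 2 = 0"
    using c by simp
  then have "to_ac (c ^ 3 + 2 * c ^ 2 + 2 * c + 2) = 0"
    by simp
  then show "to_ac c ^ 3 + 2 * to_ac c ^ 2 + 2 * to_ac c + 2 = 0"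
    by simp
  have "(2 :: 'k) \<noteq> 0"
  proof
    assume "(2 :: 'k) = 0"
    then have "of_nat 2 = (0 :: 'k)" by simp
    then have "CHAR('k) dvd 2" by (simp only: of_nat_eq_0_iff_char_dvd)
    moreover have "CHAR('k) \<noteq> 1" by simp
    ultimately show False
      using assms(1) by (metis prime_nat_iff two_is_prime_nat)
  qed
  then show "(2 :: 'k alg_closure) \<noteq> 0"
    by (metis to_ac_eq_0_iff to_ac_numeral)
  have "\<zeta>4 ^ 4 = 1" "\<zeta>4 ^ 2 \<noteq> 1"
    using assms(5) by (simp_all add: primitive_root_of_unity_def)
  moreover have "\<zeta>4 ^ 4 = (\<zeta>4 ^ 2) ^ 2"
    by simp
  ultimately show "\<zeta>4 ^ 2 = - 1"
    by (metis power2_eq_1_iff)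
  show "sqrt2 ^ 2 = 2" by fact
qed

lemma tree_autI:
  assumes "g [] = []" "\<And>w l. g (w @ [l]) = g w @ [shift (Par g w) l]"
  shows "g \<in> tree_aut"
proof -
  have len: "length (g w) = length w" for w
    by (induction w rule: rev_induct) (simp_all add: assms)
  have inj: "u = v" if "g u = g v" for u v
    using that
  proof (induction u arbitrary: v rule: rev_induct)
    case Nil
    then show ?case using len by (metis length_0_conv)
  next
    case (snoc k u)
    obtain v' l where v: "v = v' @ [l]"
      using snoc.prems len by (metis length_0_conv append_is_Nil_conv not_Cons_self2 rev_exhaust)
    then have "u = v'" "shift (Par g u) k = shift (Par g v') l"
      using snoc by (simp_all add: assms)
    then show ?case using v by (metis shift_simps(3))
  qed
  have "\<exists>u. g u = v" for v
  proof (induction v rule: rev_induct)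
    case (snoc l v)
    then obtain u where "g u = v" by blast
    then have "g (u @ [shift (Par g u) l]) = v @ [l]" by (simp add: assms)
    then show ?case by blast
  qed (use assms in blast)
  then have "bij g"
    using inj by (metis bijI injI surjI surj_def)
  moreover have "is_child (g x) (g y) \<longleftrightarrow> is_child x y" for x y
  proof
    assume "is_child (g x) (g y)"
    then obtain l where l: "g y = g x @ [l]" by (auto simp: is_child_def)
    then obtain y' k where y: "y = y' @ [k]"
      using assms(1) by (metis append_is_Nil_conv not_Cons_self2 rev_exhaust)
    then have "g y' = g x" using l by (simp add: assms)
    then show "is_child x y" using inj y by (auto simp: is_child_def)
  qed (auto simp: is_child_def assms)
  ultimately show ?thesis
    using assms(1) by (simp add: tree_aut_def)
qed

section \<open>From the Galois group to homomorphisms acting on the tree\<close>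

lemma ring_of_type_algebra_minus: "\<ominus>\<^bsub>ring_of_type_algebra\<^esub> x = - (x :: 'a::field)"
proof -
  interpret R: field "ring_of_type_algebra :: 'a ring" by (rule field_from_type_algebra)
  show ?thesis
    by (rule R.minus_equality) (simp_all add: ring_of_type_algebra_def)
qed

lemma ring_of_type_algebra_inverse:
  assumes "x \<noteq> 0"
  shows "inv\<^bsub>ring_of_type_algebra\<^esub> x = inverse (x :: 'a::field)"
proof -
  interpret R: field "ring_of_type_algebra :: 'a ring" by (rule field_from_type_algebra)
  show ?thesis
    by (rule R.comm_inv_char) (use assms in \<open>simp_all add: ring_of_type_algebra_def\<close>)
qed

lemma galois_inf_hom:
  assumes "\<sigma> \<in> galois_inf c x0"
  shows "field_hom_on (K_inf c x0) \<sigma>"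
proof -
  let ?R = "ring_of_type_algebra :: 'a alg_closure ring"
  have hom: "\<sigma> \<in> ring_hom (K_inf_ring c x0) (K_inf_ring c x0)"
    using assms by (simp add: galois_inf_def ring_iso_def)
  show ?thesis
  proof
    show "1 \<in> K_inf c x0"
      using generate_field.one[of ?R] unfolding K_inf_def by (simp add: ring_of_type_algebra_def)
    show "- u \<in> K_inf c x0" if "u \<in> K_inf c x0" for u
      using that generate_field.a_inv[of _ ?R] unfolding K_inf_def ring_of_type_algebra_minus by blast
    show "u + v \<in> K_inf c x0" if "u \<in> K_inf c x0" "v \<in> K_inf c x0" for u v
      using that generate_field.eng_add[of _ ?R] unfolding K_inf_def by (simp add: ring_of_type_algebra_def)
    show "u * v \<in> K_inf c x0" if "u \<in> K_inf c x0" "v \<in> K_inf c x0" for u v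
      using that generate_field.eng_mult[of _ ?R] unfolding K_inf_def by (simp add: ring_of_type_algebra_def)
    \<comment> \<open>Zero is treated apart: the inverse of the ring record is known only for
      nonzero elements, while \<open>inverse 0 = 0\<close>.\<close>
    show "inverse u \<in> K_inf c x0" if "u \<in> K_inf c x0" for u
      using that generate_field.m_inv[of u ?R] ring_of_type_algebra_inverse[of u]
      unfolding K_inf_def by (cases "u = 0") (simp_all add: ring_of_type_algebra_def)
    show "\<sigma> 1 = 1" "\<And>u v. u \<in> K_inf c x0 \<Longrightarrow> v \<in> K_inf c x0 \<Longrightarrow> \<sigma> (u + v) = \<sigma> u + \<sigma> v"
      "\<And>u v. u \<in> K_inf c x0 \<Longrightarrow> v \<in> K_inf c x0 \<Longrightarrow> \<sigma> (u * v) = \<sigma> u * \<sigma> v"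
      using ring_hom_one[OF hom] ring_hom_add[OF hom] ring_hom_mult[OF hom]
      by (simp_all add: K_inf_ring_def ring_of_type_algebra_def)
  qed
qed

text \<open>As \<sigma> commutes with f and fixes x0, it maps each level of preimages to itself, so
  the word described by \<open>tree_action\<close> exists; it is unique by
  \<open>labeling_inj\<close>.\<close>

lemma tree_hom_of_galois:
  fixes c x0 :: "'k::field"
  assumes "param (to_ac c) \<zeta> s" "\<And>i. x0 \<noteq> (quad c ^^ i) 0"
    and good: "good_labeling c x0 \<zeta> s lab" and \<sigma>: "\<sigma> \<in> galois_inf c x0"
  defines "g \<equiv> tree_action lab \<sigma>"
  shows "tree_hom (to_ac c) \<zeta> s (K_inf c x0) \<sigma> lab g" "g [] = []"
proof -
  interpret param "to_ac c" \<zeta> s by fact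
  interpret field_hom_on "K_inf c x0" \<sigma> by (rule galois_inf_hom) fact
  have labeling: "labeling c x0 lab"
    using good by (simp add: good_labeling_def)
  then have root: "lab [] = to_ac x0" and rooted: "\<And>n. rooted (to_ac c) n lab"
    using labeling_iff_rooted[OF two_nonzero assms(2)] by blast+
  note inj = labeling_inj[OF rooted two_nonzero]
  have fixed: "\<sigma> (to_ac u) = to_ac u" for u
    using \<sigma> by (simp add: galois_inf_def)
  have base: "to_ac u \<in> K_inf c x0" for u
    unfolding K_inf_def by (rule generate_field.incl) simp
  have lab: "(quad (to_ac c) ^^ length w) (lab w) = to_ac x0" for w
    using rooted_iter[OF rooted le_refl] root by simp
  have lab_closed: "lab w \<in> K_inf c x0" for w
    unfolding K_inf_def using lab by (auto simp: preimages_def intro!: generate_field.incl)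
  have hom_quad: "quad (to_ac c) z \<in> K_inf c x0 \<and> \<sigma> (quad (to_ac c) z) = quad (to_ac c) (\<sigma> z)"
    if "z \<in> K_inf c x0" for z
    using that by (simp add: quad_def closed hom base fixed)
  have hom_iter: "(quad (to_ac c) ^^ n) z \<in> K_inf c x0 \<and>
      \<sigma> ((quad (to_ac c) ^^ n) z) = (quad (to_ac c) ^^ n) (\<sigma> z)" if "z \<in> K_inf c x0" for z n
    using that hom_quad by (induction n) auto
  have g: "length (g w) = length w \<and> lab (g w) = \<sigma> (lab w)" for w
  proof -
    have "(quad (to_ac c) ^^ length w) (\<sigma> (lab w)) = lab []"
      using hom_iter[OF lab_closed, of "length w" w] lab[of w] fixed root by simp
    then have "\<sigma> (lab w) \<in> lab ` words (length w)"
      using preimages_eq[OF rooted, of "length w"] by blast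
    then obtain v where v: "length v = length w" "lab v = \<sigma> (lab w)"
      by (auto simp: words_def)
    show ?thesis
      unfolding g_def tree_action_def by (rule theI[of _ v]) (use v inj in auto)
  qed
  have inj_\<sigma>: "u = v" if "\<sigma> u = \<sigma> v" "u \<in> K_inf c x0" "v \<in> K_inf c x0" for u v
    using hom_nonzero[of "u - v"] that by (auto simp: closed hom_add[of u "- v", simplified] hom)
  have inj_g: "u = v" if "g u = g v" for u v
    using that g inj inj_\<sigma>[OF _ lab_closed lab_closed] by metis
  have quad_lab: "quad (to_ac c) (lab (w @ [l])) = lab w" for w l
    using fibre_eq[OF rooted, of w] by (cases l) auto
  have child: "\<exists>k. g (w @ [l]) = g w @ [k]" for w l
  proof -
    obtain v k where v: "g (w @ [l]) = v @ [k]"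
      using g[of "w @ [l]"] by (metis length_0_conv append_is_Nil_conv not_Cons_self2 rev_exhaust)
    \<comment> \<open>Applying f leads from a child's label to its parent's and commutes with
      \<sigma>; injectivity on the level then identifies the parent.\<close>
    have "lab v = quad (to_ac c) (\<sigma> (lab (w @ [l])))"
      using quad_lab[of v k] v g[of "w @ [l]"] by simp
    also have "\<dots> = lab (g w)"
      using hom_quad[OF lab_closed] quad_lab[of w l] g[of w] by metis
    finally have "v = g w"
      using inj[of v "g w"] g[of w] g[of "w @ [l]"] v by simp
    then show ?thesis using v by blast
  qed
  have g_append: "g (w @ [l]) = g w @ [shift (Par g w) l]" for w l
  proof -
    obtain k k' where k: "g (w @ [A]) = g w @ [k]" "g (w @ [B]) = g w @ [k']"
      using child by metis
    \<comment> \<open>Distinct last letters leave only two possibilities, keeping or exchanging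
      them, and \<open>Par\<close> tells which.\<close>
    moreover have "k \<noteq> k'"
      using inj_g[of "w @ [A]" "w @ [B]"] k by auto
    ultimately show ?thesis
      by (cases l; cases k; cases k') (simp_all add: Par_def)
  qed
  have "zeta4_condition lab \<zeta>" "sqrt2_condition (to_ac c) lab s"
    using good by (simp_all add: good_labeling_def)
  then show "tree_hom (to_ac c) \<zeta> s (K_inf c x0) \<sigma> lab g"
    using zeta4_condition_iff[OF rooted] sqrt2_condition_iff[OF rooted] rooted lab_closed base fixed g
      g_append
    by unfold_locales auto
  show "g [] = []"
    using g[of "[]"] by simp
qed

theorem theorem4p5:
  fixes c x0 :: "'k::field"
    and \<zeta>4 sqrt2 :: "'k alg_closure"
  assumes "CHAR('k) \<noteq> 2"
    and "strictly_preperiodic (quad c) 0"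
    and "minimal_opposite (quad c) 3 2"
    and "\<forall>i. x0 \<noteq> (quad c ^^ i) 0"
    and "sqrt2 ^ 2 = 2"
    and "primitive_root_of_unity 4 \<zeta>4"
  shows "(\<exists>lab. good_labeling c x0 \<zeta>4 sqrt2 lab) \<and>
    (\<forall>lab. good_labeling c x0 \<zeta>4 sqrt2 lab \<longrightarrow>
       (\<forall>x. \<forall>\<sigma>\<in>galois_inf c x0. \<sigma> sqrt2 = sign_of (R32 (tree_action lab \<sigma>) x) * sqrt2) \<and>
       tree_action lab ` galois_inf c x0 \<subseteq> Mtilde32 \<and>
       (\<zeta>4 \<in> range to_ac \<and> sqrt2 \<in> range to_ac \<longrightarrow>
          tree_action lab ` galois_inf c x0 \<subseteq> Btilde32))"
proof -
  have param: "param (to_ac c) \<zeta>4 sqrt2"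
    using param_of_postcritical assms by blast
  interpret param "to_ac c" \<zeta>4 sqrt2 by fact
  have orbit: "x0 \<noteq> (quad c ^^ i) 0" for i
    using assms(4) by blast
  have "\<exists>lab. good_labeling c x0 \<zeta>4 sqrt2 lab"
  proof -
    have "(quad (to_ac c) ^^ i) 0 = to_ac ((quad c ^^ i) 0)" for i
      by (induction i) (simp_all add: quad_def)
    then have "to_ac x0 \<noteq> (quad (to_ac c) ^^ i) 0" for i
      using orbit by simp
    then obtain lab where lab: "\<And>n. admissible (to_ac c) \<zeta>4 sqrt2 (to_ac x0) n lab"
      using admissible_exists[OF param] by blast
    then have rooted: "\<And>n. rooted (to_ac c) n lab" and "lab [] = to_ac x0"
      and "\<And>x l. zeta_at lab \<zeta>4 x l" "\<And>x. sqrt_at (to_ac c) lab sqrt2 x"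
      unfolding admissible_def by (blast intro: le_refl)+
    then have "good_labeling c x0 \<zeta>4 sqrt2 lab"
      using labeling_iff_rooted[OF two_nonzero orbit]
      by (simp add: good_labeling_def zeta4_condition_iff[OF rooted] sqrt2_condition_iff[OF rooted])
    then show ?thesis by blast
  qed
  moreover have "(\<forall>x. \<sigma> sqrt2 = sign_of (R32 (tree_action lab \<sigma>) x) * sqrt2) \<and>
      tree_action lab \<sigma> \<in> Mtilde32 \<and>
      (\<zeta>4 \<in> range to_ac \<and> sqrt2 \<in> range to_ac \<longrightarrow> tree_action lab \<sigma> \<in> Btilde32)"
    if good: "good_labeling c x0 \<zeta>4 sqrt2 lab" and \<sigma>: "\<sigma> \<in> galois_inf c x0" for lab \<sigma>
  proof -
    define g where "g = tree_action lab \<sigma>"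
    interpret tree_hom "to_ac c" \<zeta>4 sqrt2 "K_inf c x0" \<sigma> lab g
      using tree_hom_of_galois(1)[OF param orbit good \<sigma>] by (simp add: g_def)
    have aut: "g \<in> tree_aut"
      using tree_autI[of g] tree_hom_of_galois(2)[OF param orbit good \<sigma>] g_append
      by (simp add: g_def)
    \<comment> \<open>With \<open>e\<close> taken from \<open>hom_sqrt\<close> at another node this
      gives independence of the node; with \<open>e = 0\<close> it gives the vanishing required by
      \<open>Btilde32\<close>.\<close>
    have R: "R32 g x = e" if "\<sigma> sqrt2 = sign_of e * sqrt2" for x e
      using hom_sqrt[of x] that s_nonzero sign_of_eq_iff[OF two_nonzero] by simp
    have P: "P32 g l x = e" if "\<sigma> \<zeta>4 = sign_of e * \<zeta>4" for l x e
      using hom_zeta[of l x] that zeta_nonzero sign_of_eq_iff[OF two_nonzero] by simp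
    have fixed: "\<sigma> u = u" if "u \<in> range to_ac" for u
      using \<sigma> that by (auto simp: galois_inf_def)
    have "g \<in> M32"
      using aut P32_const unfolding M32_def by blast
    then have "g \<in> Mtilde32"
      using R[OF hom_sqrt] unfolding Mtilde32_def by blast
    moreover have "g \<in> Btilde32" if "\<zeta>4 \<in> range to_ac" "sqrt2 \<in> range to_ac"
      using \<open>g \<in> M32\<close> \<open>g \<in> Mtilde32\<close> R[of 0] P[of 0] fixed that
      by (simp add: Btilde32_def B32_def)
    ultimately show ?thesis
      using hom_sqrt unfolding g_def by blast
  qed
  ultimately show ?thesis by blast
qed

end
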